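(* Let $H$ be a separable infinite-dimensional complex Hilbert space. Every operator $T\in L(H)$ of class $C_0$ has a non-trivial invariant subspace.
   Context: $L(H)$ is the set of bounded linear operators from $H$ to $H$. A contraction is an operator $T\in L(H)$ with $\|T\|\le 1$; it is completely non-unitary if its restriction to any non-zero reducing subspace is never unitary. $H^{\infty}$ is the Banach space of bounded analytic complex-valued functions on the open unit disk $\mathbf{D}$ with the supremum norm. For a completely non-unitary contraction $T$ there is a unique algebra representation $\Phi_T:H^\infty\to L(H)$ (the Sz.-Nagy--Foias functional calculus) such that $\Phi_T(1)=I_H$; $\Phi_T(g)=T$ for $g(z)=z$; $\Phi_T$ is continuous when $H^\infty$ and $L(H)$ are given their weak$^*$ topologies; and $\|\Phi_T(u)\|\le\|u\|$ for all $u\in H^\infty$. An operator $T$ is of class $C_0$ (a $C_0$-operator) if it is a completely non-unitary contraction and $\ker\Phi_T\neq\{0\}$. A non-trivial invariant subspace of $T$ is a closed linear subspace $M\subseteq H$ with $TM\subseteq M$, $M\neq\{0\}$ and $M\neq H$. *)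

theory Defs
  imports "HOL-Complex_Analysis.Complex_Analysis"
begin

text \<open>The inner product is linear in its first argument. The last axiom says both that the
  inner product is positive definite and that it induces the norm.\<close>

class complex_hilbert = banach +
  fixes scaleC :: "complex \<Rightarrow> 'a \<Rightarrow> 'a" (infixr \<open>*\<^sub>C\<close> 75)
    and cinner :: "'a \<Rightarrow> 'a \<Rightarrow> complex"
  assumes scaleC_add_right: "a *\<^sub>C (x + y) = a *\<^sub>C x + a *\<^sub>C y"
    and scaleC_add_left: "(a + b) *\<^sub>C x = a *\<^sub>C x + b *\<^sub>C x"
    and scaleC_scaleC: "a *\<^sub>C b *\<^sub>C x = (a * b) *\<^sub>C x"
    and scaleR_scaleC: "r *\<^sub>R x = complex_of_real r *\<^sub>C x"
    and cinner_add_left: "cinner (x + y) z = cinner x z + cinner y z"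
    and cinner_scaleC_left: "cinner (a *\<^sub>C x) y = a * cinner x y"
    and cinner_commute: "cinner x y = cnj (cinner y x)"
    and cinner_self: "cinner x x = complex_of_real ((norm x)\<^sup>2)"

global_interpretation complex_vector: vector_space "scaleC :: complex \<Rightarrow> 'a \<Rightarrow> 'a::complex_hilbert"
  defines csubspace = complex_vector.subspace
    and cspan = complex_vector.span
proof
  fix a b :: complex and x y :: 'a
  show "a *\<^sub>C (x + y) = a *\<^sub>C x + a *\<^sub>C y" by (rule scaleC_add_right)
  show "(a + b) *\<^sub>C x = a *\<^sub>C x + b *\<^sub>C x" by (rule scaleC_add_left)
  show "a *\<^sub>C b *\<^sub>C x = (a * b) *\<^sub>C x" by (rule scaleC_scaleC)
  show "1 *\<^sub>C x = x" using scaleR_scaleC [of 1 x] by simp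
qed

definition infinite_dimensional :: "'h::complex_hilbert itself \<Rightarrow> bool" where
  "infinite_dimensional _ \<longleftrightarrow> \<not> (\<exists>B :: 'h set. finite B \<and> cspan B = UNIV)"

text \<open>The type \<open>'h \<Rightarrow>\<^sub>L 'h\<close> consists of the bounded real-linear operators.\<close>

definition bounded_operators :: "('h::complex_hilbert \<Rightarrow>\<^sub>L 'h) set" where
  "bounded_operators = {A :: 'h \<Rightarrow>\<^sub>L 'h. \<forall>c x. A (c *\<^sub>C x) = c *\<^sub>C A x}"

definition contraction :: "('h::complex_hilbert \<Rightarrow>\<^sub>L 'h) \<Rightarrow> bool" where
  "contraction T \<longleftrightarrow> T \<in> bounded_operators \<and> norm T \<le> 1"

definition invariant_subspace :: "('h::complex_hilbert \<Rightarrow>\<^sub>L 'h) \<Rightarrow> 'h set \<Rightarrow> bool" where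
  "invariant_subspace T M \<longleftrightarrow> csubspace M \<and> closed M \<and> T ` M \<subseteq> M"

definition nontrivial_invariant_subspace :: "('h::complex_hilbert \<Rightarrow>\<^sub>L 'h) \<Rightarrow> 'h set \<Rightarrow> bool" where
  "nontrivial_invariant_subspace T M \<longleftrightarrow> invariant_subspace T M \<and> M \<noteq> {0} \<and> M \<noteq> UNIV"

definition ortho_complement :: "'h::complex_hilbert set \<Rightarrow> 'h set" where
  "ortho_complement M = {x. \<forall>y\<in>M. cinner x y = 0}"

definition reducing_subspace :: "('h::complex_hilbert \<Rightarrow>\<^sub>L 'h) \<Rightarrow> 'h set \<Rightarrow> bool" where
  "reducing_subspace T M \<longleftrightarrow> invariant_subspace T M \<and> invariant_subspace T (ortho_complement M)"

definition unitary_on :: "('h::complex_hilbert \<Rightarrow>\<^sub>L 'h) \<Rightarrow> 'h set \<Rightarrow> bool" where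
  "unitary_on T M \<longleftrightarrow> T ` M = M \<and> (\<forall>x\<in>M. \<forall>y\<in>M. cinner (T x) (T y) = cinner x y)"

definition completely_nonunitary :: "('h::complex_hilbert \<Rightarrow>\<^sub>L 'h) \<Rightarrow> bool" where
  "completely_nonunitary T \<longleftrightarrow> (\<forall>M. reducing_subspace T M \<and> M \<noteq> {0} \<longrightarrow> \<not> unitary_on T M)"

text \<open>A function on the open unit disk is represented by its extension by zero to the whole
  plane. With this convention the carrier below is closed under pointwise sums, products and
  scalar multiples, and two elements are equal iff they agree on the disk.\<close>

definition on_disk :: "(complex \<Rightarrow> complex) \<Rightarrow> complex \<Rightarrow> complex" where
  "on_disk f = (\<lambda>z. if z \<in> ball 0 1 then f z else 0)"

definition Hinf :: "(complex \<Rightarrow> complex) set" where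
  "Hinf = {u. u holomorphic_on ball 0 1 \<and> bounded (u ` ball 0 1) \<and> (\<forall>z. z \<notin> ball 0 1 \<longrightarrow> u z = 0)}"

definition Hinf_norm :: "(complex \<Rightarrow> complex) \<Rightarrow> real" where
  "Hinf_norm u = (SUP z\<in>ball 0 1. norm (u z))"

text \<open>The coarsest topology on \<open>S\<close> making all functionals in \<open>F\<close> continuous.\<close>

definition weak_topology :: "'a set \<Rightarrow> ('a \<Rightarrow> complex) set \<Rightarrow> 'a topology" where
  "weak_topology S F = topology_generated_by {{x \<in> S. f x \<in> U} |f U. f \<in> F \<and> open U}"

text \<open>The radial boundary function, parametrised by the angle. By Fatou's theorem the limit
  exists for almost every \<open>t\<close> if \<open>u\<close> is bounded and analytic.\<close>

definition boundary_fun :: "(complex \<Rightarrow> complex) \<Rightarrow> real \<Rightarrow> complex" where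
  "boundary_fun u t = Lim (at_left 1) (\<lambda>r. u (complex_of_real r * cis t))"

text \<open>Via boundary functions \<open>H\<^sup>\<infinity>\<close> is a weak-star closed subspace of \<open>L\<^sup>\<infinity>\<close> of the circle, the dual
  of \<open>L\<^sup>1\<close> of the circle, and its weak-star topology is the one inherited from there.\<close>

definition Hinf_weak_star :: "(complex \<Rightarrow> complex) topology" where
  "Hinf_weak_star = weak_topology Hinf
     {\<lambda>u. integral\<^sup>L (lebesgue_on {0..2*pi}) (\<lambda>t. boundary_fun u t * g t) |g.
        integrable (lebesgue_on {0..2*pi}) g}"

text \<open>\<open>L(H)\<close> is the dual of the trace class. The trace class operators are the sums of rank one
  operators \<open>\<Sum>n. \<langle>\<cdot>, y n\<rangle> x n\<close> with square summable \<open>x\<close> and \<open>y\<close>, and the pairing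
  of \<open>A\<close> with such an operator is \<open>\<Sum>n. \<langle>A (x n), y n\<rangle>\<close>.\<close>

definition operator_weak_star :: "('h::complex_hilbert \<Rightarrow>\<^sub>L 'h) topology" where
  "operator_weak_star = weak_topology bounded_operators
     {\<lambda>A :: 'h \<Rightarrow>\<^sub>L 'h. \<Sum>n. cinner (A (x n)) (y n) |(x :: nat \<Rightarrow> 'h) (y :: nat \<Rightarrow> 'h).
        summable (\<lambda>n. (norm (x n))\<^sup>2) \<and> summable (\<lambda>n. (norm (y n))\<^sup>2)}"

definition algebra_representation ::
    "((complex \<Rightarrow> complex) \<Rightarrow> ('h::complex_hilbert \<Rightarrow>\<^sub>L 'h)) \<Rightarrow> bool" where
  "algebra_representation \<Phi> \<longleftrightarrow>
     \<Phi> ` Hinf \<subseteq> bounded_operators \<and>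
     (\<forall>u\<in>Hinf. \<forall>v\<in>Hinf. \<Phi> (\<lambda>z. u z + v z) = \<Phi> u + \<Phi> v) \<and>
     (\<forall>c. \<forall>u\<in>Hinf. \<forall>x. \<Phi> (\<lambda>z. c * u z) x = c *\<^sub>C \<Phi> u x) \<and>
     (\<forall>u\<in>Hinf. \<forall>v\<in>Hinf. \<Phi> (\<lambda>z. u z * v z) = \<Phi> u o\<^sub>L \<Phi> v)"

definition sz_nagy_foias_calculus ::
    "('h::complex_hilbert \<Rightarrow>\<^sub>L 'h) \<Rightarrow> ((complex \<Rightarrow> complex) \<Rightarrow> ('h \<Rightarrow>\<^sub>L 'h)) \<Rightarrow> bool" where
  "sz_nagy_foias_calculus T \<Phi> \<longleftrightarrow>
     algebra_representation \<Phi> \<and>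
     \<Phi> (on_disk (\<lambda>z. 1)) = id_blinfun \<and>
     \<Phi> (on_disk (\<lambda>z. z)) = T \<and>
     continuous_map Hinf_weak_star operator_weak_star \<Phi> \<and>
     (\<forall>u\<in>Hinf. norm (\<Phi> u) \<le> Hinf_norm u)"

text \<open>The calculus of a completely non-unitary contraction exists and is unique, so that the
  existential quantifier below just names it.\<close>

definition class_C0 :: "('h::complex_hilbert \<Rightarrow>\<^sub>L 'h) \<Rightarrow> bool" where
  "class_C0 T \<longleftrightarrow> contraction T \<and> completely_nonunitary T \<and>
     (\<exists>\<Phi>. sz_nagy_foias_calculus T \<Phi> \<and> {u \<in> Hinf. \<Phi> u = 0} \<noteq> {\<lambda>z. 0})"

end

theory Submission
  imports Defs
begin

text \<open>
  Let \<open>\<Phi>\<close> be the functional calculus of \<open>T\<close> and let \<open>K \<subseteq> H\<^sup>\<infinity>\<close> be its kernel, which contains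
  some \<open>u \<noteq> 0\<close>. Suppose that \<open>T\<close> has no non-trivial invariant subspace. The kernel of every
  \<open>\<Phi> v\<close> is a closed subspace invariant under \<open>T\<close>, because \<open>\<Phi> v\<close> commutes with \<open>T\<close>. Hence every
  \<open>\<Phi> v\<close> is either zero or injective, which makes \<open>K\<close> a prime ideal. It contains no Moebius
  function with zero \<open>a\<close>, since otherwise \<open>T\<close> would be the scalar operator \<open>a\<close>,
  which has many invariant subspaces (\<open>calculus_kernel_prime\<close>). The contradiction comes from the fact
  that the constant 1 lies in the weak-star closure of such an ideal: a sequence in \<open>K\<close> tends to 1, so
  that weak-star continuity of \<open>\<Phi>\<close> gives \<open>\<Phi> 1 = 0\<close>, whereas \<open>\<Phi> 1\<close> is the identity.

  The sequence is produced inside the closed unit ball of \<open>H\<^sup>\<infinity>\<close>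
  (\<open>approximates_one\<close>). Zeros of a function in \<open>K\<close> may be divided out as Moebius factors without
  leaving \<open>K\<close>. Doing so on larger and larger disks yields in the limit a factorisation \<open>b v\<close>, where
  \<open>v\<close> has no zeros and \<open>b\<close> plays the role of a Blaschke product. As \<open>K\<close> is prime, it contains \<open>v\<close> or
  \<open>b\<close>. If it contains \<open>v\<close>, then it contains the roots of \<open>v\<close> of order \<open>2\<^sup>n\<close>, and they tend to 1. If
  it contains \<open>b\<close>, then it contains the tails of the product \<open>b\<close>, whose values at 0 tend to 1.

  For functions \<open>w\<close> bounded by 1, convergence of the values at 0 to 1 is enough for weak-star
  convergence of a subsequence, because the mean of \<open>|1 - w|\<^sup>2\<close> over the unit circle is at most
  \<open>2 (1 - Re w(0))\<close>. That argument is about boundary functions and therefore needs Fatou's theorem on radial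
  limits (\<open>fatou_radial_limits\<close>). The proof of Fatou's theorem is the classical one: the Poisson
  integral bounds the radial maximal function by the Hardy--Littlewood maximal function, Vitali's
  covering lemma bounds the latter, and Taylor polynomials approximate in mean square.
\<close>

section \<open>The closed unit ball of bounded analytic functions\<close>

definition schur_class :: "(complex \<Rightarrow> complex) set" where
  "schur_class = {u \<in> Hinf. \<forall>z\<in>ball 0 1. norm (u z) \<le> 1}"

lemma on_disk_eq [simp]: "norm z < 1 \<Longrightarrow> on_disk f z = f z"
  by (simp add: on_disk_def)

lemma on_disk_in_Hinf:
  assumes "f holomorphic_on ball 0 1" and "\<And>z. norm z < 1 \<Longrightarrow> norm (f z) \<le> B"
  shows "on_disk f \<in> Hinf"
proof -
  have "on_disk f holomorphic_on ball 0 1"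
    using assms(1) by (rule holomorphic_transform) simp
  moreover have "bounded (on_disk f ` ball 0 1)"
    using assms(2) by (auto simp: bounded_iff intro!: exI [of _ B])
  ultimately show ?thesis
    by (auto simp: Hinf_def on_disk_def)
qed

lemma on_disk_in_schur_class:
  assumes "f holomorphic_on ball 0 1" and "\<And>z. norm z < 1 \<Longrightarrow> norm (f z) \<le> 1"
  shows "on_disk f \<in> schur_class"
  using on_disk_in_Hinf [OF assms] assms(2) by (auto simp: schur_class_def)

lemma Hinf_outside: "u \<in> Hinf \<Longrightarrow> \<not> norm z < 1 \<Longrightarrow> u z = 0"
  by (auto simp: Hinf_def)

lemma Hinf_eqI:
  assumes "u \<in> Hinf" "v \<in> Hinf" "\<And>z. norm z < 1 \<Longrightarrow> u z = v z"
  shows "u = v"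
  using assms Hinf_outside by (metis ext)

lemma Hinf_mult:
  assumes "u \<in> Hinf" "v \<in> Hinf"
  shows "(\<lambda>z. u z * v z) \<in> Hinf"
proof -
  obtain A B where "\<And>z. norm z < 1 \<Longrightarrow> norm (u z) \<le> A" "\<And>z. norm z < 1 \<Longrightarrow> norm (v z) \<le> B"
    using assms by (fastforce simp: Hinf_def bounded_iff)
  then have "norm (u z * v z) \<le> A * B" if "norm z < 1" for z
    using that by (metis norm_mult mult_mono norm_ge_zero order_trans)
  then show ?thesis
    using assms by (auto simp: Hinf_def bounded_iff intro!: holomorphic_intros exI [of _ "A * B"])
qed

lemma schur_class_mult:
  assumes "u \<in> schur_class" "v \<in> schur_class"
  shows "(\<lambda>z. u z * v z) \<in> schur_class"
  using assms Hinf_mult by (auto simp: schur_class_def norm_mult intro!: mult_le_one)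

lemma schur_class_holomorphic: "u \<in> schur_class \<Longrightarrow> u holomorphic_on ball 0 1"
  by (simp add: schur_class_def Hinf_def)

lemma schur_class_norm: "u \<in> schur_class \<Longrightarrow> norm z < 1 \<Longrightarrow> norm (u z) \<le> 1"
  by (simp add: schur_class_def)

lemma schur_class_Hinf: "u \<in> schur_class \<Longrightarrow> u \<in> Hinf"
  by (simp add: schur_class_def)

text \<open>The strict hypothesis of the Schwarz lemma is met by \<open>t f\<close> for \<open>t < 1\<close>; let \<open>t\<close> tend to 1.\<close>

lemma Schwarz_Lemma_nonstrict:
  assumes holf: "f holomorphic_on ball 0 1" and f0: "f 0 = 0"
    and no: "\<And>z. norm z < 1 \<Longrightarrow> norm (f z) \<le> 1" and z: "norm z < 1"
  shows "norm (f z) \<le> norm z"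
proof -
  have less: "t * norm (f z) \<le> norm z" if t: "0 < t" "t < 1" for t :: real
  proof -
    have "norm (of_real t * f z) \<le> norm z"
    proof (rule Schwarz_Lemma(1) [of "\<lambda>z. of_real t * f z"])
      fix w :: complex assume "norm w < 1"
      then have "t * norm (f w) \<le> t * 1"
        using no t by (intro mult_left_mono) auto
      then have "t * norm (f w) < 1" using t by linarith
      then show "norm (of_real t * f w) < 1"
        using t by (simp add: norm_mult)
    qed (use f0 z in \<open>auto intro!: holomorphic_intros holf\<close>)
    then show ?thesis using t by (simp add: norm_mult)
  qed
  show ?thesis
  proof (rule field_le_mult_one_interval)
    fix t :: real assume "0 < t" "t < 1"
    then show "t * norm (f z) \<le> norm z" by (rule less)
  qed
qed

lemma moebius_denominator_nonzero:
  assumes "norm a < 1" "norm z < 1"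
  shows "1 - cnj a * z \<noteq> 0"
proof
  assume "1 - cnj a * z = 0"
  then have "norm a * norm z = 1"
    by (metis complex_mod_cnj norm_mult norm_one right_minus_eq)
  moreover have "norm a * norm z < 1"
    using assms by (metis mult_strict_mono' norm_ge_zero mult_1)
  ultimately show False by simp
qed

text \<open>A Moebius change of variable moves the zero to the origin, where the Schwarz lemma says that
  dividing by the coordinate does not increase the bound. The quotient is analytic at \<open>a\<close> because
  the singularity there is removable.\<close>

lemma schur_class_divide_zero:
  assumes f: "f \<in> schur_class" and a: "norm a < 1" and fa: "f a = 0"
  obtains g where "g \<in> schur_class" "f = (\<lambda>z. on_disk (Moebius_function 0 a) z * g z)"
proof -
  let ?b = "Moebius_function 0 a"
  define q where "q = (\<lambda>z. if z = a then deriv f a else (f z - f a) / (z - a))"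
  define g where "g = (\<lambda>z. (1 - cnj a * z) * q z)"
  have ai: "a \<in> ball 0 1" using a by simp
  have "q holomorphic_on ball 0 1"
    unfolding q_def using pole_lemma [OF schur_class_holomorphic [OF f], of a] ai by simp
  then have holg: "g holomorphic_on ball 0 1"
    unfolding g_def by (intro holomorphic_intros)
  note nz = moebius_denominator_nonzero [OF a]
  have fg: "f z = ?b z * g z" if "norm z < 1" for z
    using nz [OF that] fa by (cases "z = a") (simp_all add: Moebius_function_simple g_def q_def)
  have bb: "?b (Moebius_function 0 (-a) z) = z" "norm (Moebius_function 0 (-a) z) < 1" if "norm z < 1" for z
    using that a by (auto intro!: Moebius_function_compose Moebius_function_norm_lt_1)
  have bb': "Moebius_function 0 (-a) (?b z) = z" "norm (?b z) < 1" if "norm z < 1" for z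
    using that a by (auto intro!: Moebius_function_compose Moebius_function_norm_lt_1)
  have le: "norm (f z) \<le> norm (?b z)" if z: "norm z < 1" for z
  proof -
    have "(f \<circ> Moebius_function 0 (-a)) holomorphic_on ball 0 1"
      using Moebius_function_holomorphic [of "-a" 0] a bb(2)
      by (intro holomorphic_on_compose_gen [OF _ schur_class_holomorphic [OF f]]) auto
    then have "norm ((f \<circ> Moebius_function 0 (-a)) (?b z)) \<le> norm (?b z)"
      by (rule Schwarz_Lemma_nonstrict)
        (use bb bb' z fa f in \<open>auto simp: schur_class_norm Moebius_function_simple\<close>)
    then show ?thesis using bb' z by simp
  qed
  have le1: "norm (g z) \<le> 1" if z: "norm z < 1" "z \<noteq> a" for z
  proof -
    have "?b z \<noteq> 0" using z nz by (simp add: Moebius_function_simple)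
    then show ?thesis
      using le [OF z(1)] fg [OF z(1)] by (simp add: norm_mult)
  qed
  have "norm (g a) \<le> 1"
  proof (rule tendsto_upperbound)
    have "isCont g a"
      using holg ai by (metis continuous_on_interior holomorphic_on_imp_continuous_on interior_open open_ball)
    then show "((\<lambda>z. norm (g z)) \<longlongrightarrow> norm (g a)) (at a)"
      by (intro tendsto_norm) (simp add: isCont_def)
    have "\<forall>\<^sub>F z in at a. z \<in> ball 0 1"
      using ai by (intro eventually_at_in_open') auto
    moreover have "\<forall>\<^sub>F z in at a. z \<noteq> a"
      by (simp add: eventually_at_filter)
    ultimately show "\<forall>\<^sub>F z in at a. norm (g z) \<le> 1"
      by eventually_elim (use le1 in auto)
  qed auto
  then have "on_disk g \<in> schur_class"
    using le1 holg by (intro on_disk_in_schur_class) auto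
  moreover have "f z = on_disk ?b z * on_disk g z" for z
    using fg Hinf_outside [OF schur_class_Hinf [OF f]]
    by (cases "norm z < 1") (auto simp: on_disk_def)
  ultimately show thesis using that by blast
qed

section \<open>Prime ideals without Moebius functions\<close>

locale prime_without_moebius =
  fixes K :: "(complex \<Rightarrow> complex) set"
  assumes absorb: "u \<in> K \<Longrightarrow> v \<in> Hinf \<Longrightarrow> (\<lambda>z. v z * u z) \<in> K"
    and prime: "u \<in> Hinf \<Longrightarrow> v \<in> Hinf \<Longrightarrow> (\<lambda>z. u z * v z) \<in> K \<Longrightarrow> u \<in> K \<or> v \<in> K"
    and moebius_notin: "norm a < 1 \<Longrightarrow> on_disk (Moebius_function 0 a) \<notin> K"
begin

text \<open>The factor that is split off lies outside the prime ideal \<open>K\<close>, so that \<open>f \<in> K\<close> forces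
  \<open>g \<in> K\<close>.\<close>

definition cofactor :: "(complex \<Rightarrow> complex) \<Rightarrow> (complex \<Rightarrow> complex) \<Rightarrow> bool" where
  "cofactor f g \<longleftrightarrow> f \<in> schur_class \<and> g \<in> schur_class \<and>
     (\<exists>b\<in>schur_class. b \<notin> K \<and> f = (\<lambda>z. b z * g z))"

lemma moebius_schur: "norm a < 1 \<Longrightarrow> on_disk (Moebius_function 0 a) \<in> schur_class"
  using Moebius_function_norm_lt_1 Moebius_function_holomorphic
  by (intro on_disk_in_schur_class) (auto intro: less_imp_le)

lemma one_notin: "on_disk (\<lambda>z. 1) \<notin> K"
proof
  let ?m = "on_disk (Moebius_function 0 0)"
  assume "on_disk (\<lambda>z. 1) \<in> K"
  then have "(\<lambda>z. ?m z * on_disk (\<lambda>z. 1) z) \<in> K"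
    using moebius_schur [of 0] by (intro absorb schur_class_Hinf) auto
  moreover have "(\<lambda>z. ?m z * on_disk (\<lambda>z. 1) z) = ?m"
    by (auto simp: on_disk_def)
  ultimately show False using moebius_notin [of 0] by simp
qed

lemma cofactor_refl: "f \<in> schur_class \<Longrightarrow> cofactor f f"
proof -
  assume f: "f \<in> schur_class"
  have 1: "on_disk (\<lambda>z. 1) \<in> schur_class"
    by (intro on_disk_in_schur_class) auto
  have "f = (\<lambda>z. on_disk (\<lambda>z. 1) z * f z)"
    using f 1 by (intro Hinf_eqI Hinf_mult schur_class_Hinf) auto
  then show ?thesis
    using f 1 one_notin by (auto simp: cofactor_def)
qed

lemma cofactor_trans:
  assumes "cofactor f g" "cofactor g h"
  shows "cofactor f h"
proof -
  obtain b c where "b \<in> schur_class" "b \<notin> K" "f = (\<lambda>z. b z * g z)"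
      and "c \<in> schur_class" "c \<notin> K" "g = (\<lambda>z. c z * h z)"
    using assms by (auto simp: cofactor_def)
  then show ?thesis
    using assms prime [of b c] schur_class_mult [of b c] schur_class_Hinf
    by (auto simp: cofactor_def mult.assoc intro!: bexI [of _ "\<lambda>z. b z * c z"])
qed

lemma cofactor_norm_le:
  assumes "cofactor f g"
  shows "norm (f z) \<le> norm (g z)"
proof (cases "norm z < 1")
  case True
  obtain b where "b \<in> schur_class" "f = (\<lambda>z. b z * g z)"
    using assms by (auto simp: cofactor_def)
  then show ?thesis
    using True schur_class_norm by (simp add: norm_mult mult_left_le_one_le)
next
  case False
  then show ?thesis
    using assms Hinf_outside schur_class_Hinf by (metis cofactor_def order_refl)
qed

lemma cofactor_in:
  assumes "cofactor f g" "f \<in> K"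
  shows "g \<in> K"
  using assms prime schur_class_Hinf by (fastforce simp: cofactor_def)

text \<open>Dividing out zeros in \<open>A\<close> must come to an end, because at \<open>c\<close> the modulus of each function is
  at most \<open>R\<close> times that of the next quotient, and the quotients stay bounded by 1. The point \<open>c\<close> is a parameter
  since zeros at 0 have to be removed first, and for those the origin is useless.\<close>

lemma strip_zeros:
  assumes f: "f \<in> schur_class" and c: "norm c < 1" "f c \<noteq> 0"
    and A: "A \<subseteq> ball 0 1" and R: "R < 1" "\<And>a. a \<in> A \<Longrightarrow> norm (Moebius_function 0 a c) \<le> R"
  obtains g where "cofactor f g" "\<And>a. a \<in> A \<Longrightarrow> g a \<noteq> 0"
proof (cases "\<exists>g. cofactor f g \<and> (\<forall>a\<in>A. g a \<noteq> 0)")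
  case False
  then have zero: "\<exists>a\<in>A. g a = 0" if "cofactor f g" for g using that by blast
  then obtain a0 where "a0 \<in> A" using f cofactor_refl by blast
  then have R0: "0 \<le> R" using R(2) by (meson norm_ge_zero order_trans)
  have "\<exists>g. cofactor f g \<and> norm (f c) \<le> R ^ n * norm (g c)" for n
  proof (induction n)
    case 0
    then show ?case using f cofactor_refl by auto
  next
    case (Suc n)
    then obtain g where g: "cofactor f g" "norm (f c) \<le> R ^ n * norm (g c)" by blast
    obtain a where a: "a \<in> A" "g a = 0" using zero g by blast
    have gS: "g \<in> schur_class" using g by (simp add: cofactor_def)
    have a1: "norm a < 1" using a A by auto
    obtain h where h: "h \<in> schur_class" "g = (\<lambda>z. on_disk (Moebius_function 0 a) z * h z)"
      using schur_class_divide_zero [OF gS a1 a(2)] .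
    have "cofactor g h"
      unfolding cofactor_def using h gS moebius_schur [OF a1] moebius_notin [OF a1] by blast
    moreover have "norm (g c) \<le> R * norm (h c)"
      using h(2) c R(2) [OF a(1)] by (simp add: norm_mult mult_right_mono)
    then have "R ^ n * norm (g c) \<le> R ^ n * (R * norm (h c))"
      using R0 by (intro mult_left_mono) auto
    then have "norm (f c) \<le> R ^ Suc n * norm (h c)"
      using g(2) by (simp add: mult_ac)
    ultimately show ?case using g cofactor_trans by blast
  qed
  moreover have "norm (g c) \<le> 1" if "cofactor f g" for g
    using that c by (simp add: cofactor_def schur_class_norm)
  ultimately have "norm (f c) \<le> R ^ n" for n
    using R0 by (meson mult_left_le order_trans zero_le_power)
  then have "norm (f c) \<le> 0"
    using R R0 by (intro LIMSEQ_le_const [OF LIMSEQ_power_zero [of R]]) auto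
  then show thesis using c by simp
qed (use that in blast)

text \<open>A function without zeros on the disk is \<open>exp L\<close>, and primality allows one to take square roots
  \<open>exp (L / 2\<^sup>n)\<close> again and again. They tend to 1.\<close>

lemma zero_free_approximates_one:
  assumes v: "v \<in> K" "v \<in> schur_class" and nz: "\<And>z. norm z < 1 \<Longrightarrow> v z \<noteq> 0"
  obtains w where "\<And>n. w n \<in> K" "\<And>n. w n \<in> schur_class" "(\<lambda>n. w n 0) \<longlonglongrightarrow> 1"
proof -
  obtain L where L: "L holomorphic_on ball 0 1" "\<And>z. norm z < 1 \<Longrightarrow> exp (L z) = v z"
    using holomorphic_logarithm_exists [of "ball 0 1" v 0] nz schur_class_holomorphic [OF v(2)]
    by (auto simp: mem_ball)
  define w where "w = (\<lambda>n::nat. on_disk (\<lambda>z. exp (L z / 2 ^ n)))"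
  have S: "w n \<in> schur_class" for n
    unfolding w_def
  proof (rule on_disk_in_schur_class)
    show "(\<lambda>z. exp (L z / 2 ^ n)) holomorphic_on ball 0 1"
      by (intro holomorphic_intros L) auto
    fix z :: complex assume z: "norm z < 1"
    have "exp (Re (L z)) \<le> 1"
      using schur_class_norm [OF v(2) z] L(2) [OF z] by (metis norm_exp_eq_Re)
    then show "norm (exp (L z / 2 ^ n)) \<le> 1"
      by (simp add: field_simps)
  qed
  have "w n \<in> K" for n
  proof (induction n)
    case 0
    have "w 0 = v"
      using S [of 0] v L(2) by (intro Hinf_eqI schur_class_Hinf) (auto simp: w_def)
    then show ?case using v by simp
  next
    case (Suc n)
    have "w n = (\<lambda>z. w (Suc n) z * w (Suc n) z)"
      using S [of n] S [of "Suc n"]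
      by (intro Hinf_eqI Hinf_mult schur_class_Hinf) (auto simp: w_def simp flip: exp_add)
    then show ?case using Suc prime S schur_class_Hinf by metis
  qed
  moreover have "(\<lambda>n. w n 0) \<longlonglongrightarrow> 1"
  proof -
    have "(\<lambda>n. exp (L 0 * (1/2) ^ n)) \<longlonglongrightarrow> exp (L 0 * 0)"
      by (intro tendsto_intros LIMSEQ_power_zero) (simp add: norm_divide)
    then show ?thesis by (simp add: w_def power_one_over)
  qed
  ultimately show thesis using that S by blast
qed

text \<open>The functions \<open>g n\<close> arise from \<open>f\<close> by dividing out the zeros in an increasing sequence of
  disks. Their moduli increase with \<open>n\<close>, so a locally uniform limit \<open>v\<close> of a subsequence dominates
  all of them. For this reason \<open>v\<close> has no zeros, and the quotients \<open>q n = g n / v\<close> are bounded by 1. The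
  quotient \<open>q 0\<close> stands for the Blaschke product of \<open>f\<close>, and \<open>q n\<close> for its tails.\<close>

lemma approximates_one:
  assumes u: "u \<in> K" "u \<in> Hinf" "u \<noteq> (\<lambda>z. 0)"
  obtains w where "\<And>n. w n \<in> K" "\<And>n. w n \<in> schur_class" "(\<lambda>n. w n 0) \<longlonglongrightarrow> 1"
proof -
  \<comment> \<open>Scale \<open>u\<close> into the unit ball and divide out its zero at the origin.\<close>
  obtain f where f: "f \<in> K" "f \<in> schur_class" "f 0 \<noteq> 0"
  proof -
    obtain B where B: "B > 0" "\<And>z. norm z < 1 \<Longrightarrow> norm (u z) \<le> B"
      using u(2) by (force simp: Hinf_def bounded_pos)
    define s where "s = (\<lambda>z. on_disk (\<lambda>z. 1 / of_real B) z * u z)"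
    have k: "on_disk (\<lambda>z. 1 / of_real B) \<in> Hinf"
      by (rule on_disk_in_Hinf [of _ "1/B"]) (use B in \<open>auto simp: norm_divide\<close>)
    have sK: "s \<in> K" unfolding s_def by (rule absorb [OF u(1) k])
    have sS: "s \<in> schur_class"
      unfolding schur_class_def s_def using Hinf_mult [OF k u(2)] B
      by (auto simp: norm_mult norm_divide)
    obtain c where "u c \<noteq> 0" using u(3) by auto
    then have c: "norm c < 1" "s c \<noteq> 0"
      using Hinf_outside [OF u(2)] B(1) by (force simp: s_def)+
    obtain g where g: "cofactor s g" "\<And>a. a \<in> {0} \<Longrightarrow> g a \<noteq> 0"
      by (rule strip_zeros [OF sS c, of "{0}" "norm c"]) (use c in \<open>auto simp: Moebius_function_simple\<close>)
    show thesis
      using that [of g] g cofactor_in sK by (auto simp: cofactor_def)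
  qed

  let ?P = "\<lambda>n g. g \<in> K \<and> g \<in> schur_class \<and> g 0 \<noteq> 0 \<and>
             (\<forall>a\<in>cball 0 (1 - 1 / real (Suc n)). g a \<noteq> 0)"
  have "\<exists>g. \<forall>n. ?P n (g n) \<and> cofactor (g n) (g (Suc n))"
  proof (rule dependent_nat_choice)
    show "\<exists>g. ?P 0 g" using f by auto
    fix g n assume g: "?P n g"
    let ?R = "1 - 1 / real (Suc (Suc n))"
    have sub: "cball 0 ?R \<subseteq> (ball 0 1 :: complex set)" by (force intro: order.strict_trans1)
    obtain h where h: "cofactor g h" "\<And>a. a \<in> cball 0 ?R \<Longrightarrow> h a \<noteq> 0"
      by (rule strip_zeros [of g 0 "cball 0 ?R" ?R])
        (use g sub in \<open>auto simp: Moebius_function_simple\<close>)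
    have "h 0 \<noteq> 0" using h(2) [of 0] by simp
    then show "\<exists>h. ?P (Suc n) h \<and> cofactor g h"
      using h g cofactor_in unfolding cofactor_def by blast
  qed
  then obtain g where g: "\<And>n. ?P n (g n) \<and> cofactor (g n) (g (Suc n))"
    by blast
  then have gK: "\<And>n. g n \<in> K" and gS: "\<And>n. g n \<in> schur_class"
      and gstep: "\<And>n. cofactor (g n) (g (Suc n))"
    by blast+
  have gnz: "g n a \<noteq> 0" if "norm a \<le> 1 - 1 / real (Suc n)" for n a
    using that g [of n] by auto
  have mono: "cofactor (g m) (g n)" if "m \<le> n" for m n
    using that by (induction rule: dec_induct) (use gS gstep cofactor_refl cofactor_trans in blast)+
  obtain v r where holv: "v holomorphic_on ball 0 1" and r: "strict_mono (r :: nat \<Rightarrow> nat)"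
    and lim: "\<And>z. z \<in> ball 0 1 \<Longrightarrow> (\<lambda>n. g (r n) z) \<longlonglongrightarrow> v z"
  proof (rule Montel [of "ball 0 1" schur_class g])
    show "\<exists>B. \<forall>h\<in>schur_class. \<forall>z\<in>X. norm (h z) \<le> B" if "X \<subseteq> ball 0 1" for X
      using that schur_class_norm by (intro exI [of _ 1]) auto
  qed (use gS schur_class_holomorphic that in auto)
  have le_v: "norm (g n z) \<le> norm (v z)" if "norm z < 1" for n z
  proof (rule LIMSEQ_le_const)
    show "(\<lambda>k. norm (g (r k) z)) \<longlonglongrightarrow> norm (v z)"
      using lim that by (intro tendsto_norm) auto
    show "\<exists>N. \<forall>k\<ge>N. norm (g n z) \<le> norm (g (r k) z)"
      using r by (meson cofactor_norm_le le_trans mono seq_suble)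
  qed
  have v_le: "norm (v z) \<le> 1" if "norm z < 1" for z
  proof (rule LIMSEQ_le_const2)
    show "(\<lambda>k. norm (g (r k) z)) \<longlonglongrightarrow> norm (v z)"
      using lim that by (intro tendsto_norm) auto
    show "\<exists>N. \<forall>k\<ge>N. norm (g (r k) z) \<le> 1"
      using schur_class_norm [OF gS that] by blast
  qed
  have v_nz: "v z \<noteq> 0" if z: "norm z < 1" for z
  proof -
    obtain n where "1 / real (Suc n) < 1 - norm z"
      using z by (metis diff_gt_0_iff_gt nat_approx_posE)
    then have "g n z \<noteq> 0" by (intro gnz) auto
    then show ?thesis using le_v [OF z, of n] by auto
  qed
  have vS: "on_disk v \<in> schur_class"
    using holv v_le by (rule on_disk_in_schur_class)
  define q where "q = (\<lambda>n. on_disk (\<lambda>z. g n z / v z))"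
  have qS: "q n \<in> schur_class" for n
    unfolding q_def
  proof (rule on_disk_in_schur_class)
    show "(\<lambda>z. g n z / v z) holomorphic_on ball 0 1"
      using v_nz holv schur_class_holomorphic [OF gS] by (intro holomorphic_intros) auto
    show "norm (g n z / v z) \<le> 1" if "norm z < 1" for z
      using le_v [OF that] v_nz [OF that] by (simp add: norm_divide)
  qed
  have "g 0 = (\<lambda>z. q 0 z * on_disk v z)"
    using gS qS vS v_nz by (intro Hinf_eqI Hinf_mult schur_class_Hinf) (auto simp: q_def)
  then have "q 0 \<in> K \<or> on_disk v \<in> K"
    using prime gK qS vS schur_class_Hinf by metis
  then show thesis
  proof
    assume q0: "q 0 \<in> K"
    have "q n \<in> K" for n
    proof -
      obtain b where b: "b \<in> schur_class" "b \<notin> K" "g 0 = (\<lambda>z. b z * g n z)"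
        using mono [of 0 n] by (auto simp: cofactor_def)
      have "q 0 = (\<lambda>z. b z * q n z)"
        using qS [of 0] qS [of n] b
      by (intro Hinf_eqI Hinf_mult schur_class_Hinf) (auto simp: q_def)
      then show ?thesis using prime q0 b qS schur_class_Hinf by metis
    qed
    moreover have "(\<lambda>n. q (r n) 0) \<longlonglongrightarrow> 1"
      using tendsto_divide [OF lim [of 0] tendsto_const [of "v 0"]] v_nz [of 0] by (simp add: q_def)
    ultimately show thesis
      using that [of "\<lambda>n. q (r n)"] qS by blast
  next
    assume "on_disk v \<in> K"
    then show thesis
      using zero_free_approximates_one [OF _ vS] v_nz that by auto
  qed
qed

end

section \<open>The Poisson integral\<close>

definition poisson_kernel :: "real \<Rightarrow> real \<Rightarrow> real" where
  "poisson_kernel r t = (1 - r\<^sup>2) / (1 - 2 * r * cos t + r\<^sup>2)"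

lemma poisson_denominator_pos:
  fixes r t :: real
  assumes "0 \<le> r" "r < 1"
  shows "0 < 1 - 2 * r * cos t + r\<^sup>2"
proof -
  have "0 < 1 - r" using assms by simp
  then have "0 < (1 - r)\<^sup>2" by (rule zero_less_power)
  also have "\<dots> \<le> 1 - 2 * r * cos t + r\<^sup>2"
    using assms mult_left_mono [of "cos t" 1 r] by (simp add: power2_eq_square algebra_simps)
  finally show ?thesis .
qed

lemma poisson_kernel_nonneg: "0 \<le> r \<Longrightarrow> r < 1 \<Longrightarrow> 0 \<le> poisson_kernel r t"
  unfolding poisson_kernel_def
  using poisson_denominator_pos [of r t] by (simp add: power_le_one)

lemma continuous_poisson_kernel:
  assumes "0 \<le> r" "r < 1"
  shows "continuous_on A (poisson_kernel r)"
  unfolding poisson_kernel_def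
proof (intro continuous_intros ballI)
  show "1 - 2 * r * cos t + r\<^sup>2 \<noteq> 0" for t
    using poisson_denominator_pos [OF assms, of t] by simp
qed

lemma poisson_kernel_antimono:
  assumes r: "0 \<le> r" "r < 1" and t: "0 \<le> s" "s \<le> t" "t \<le> pi"
  shows "poisson_kernel r t \<le> poisson_kernel r s"
  unfolding poisson_kernel_def
proof (rule divide_left_mono)
  have "cos t \<le> cos s" using t by (simp add: cos_mono_le_eq)
  then have "r * cos t \<le> r * cos s" using r by (simp add: mult_left_mono)
  then show "1 - 2 * r * cos s + r\<^sup>2 \<le> 1 - 2 * r * cos t + r\<^sup>2" by simp
  show "0 \<le> 1 - r\<^sup>2" using r by (simp add: power_le_one)
  show "0 < (1 - 2 * r * cos t + r\<^sup>2) * (1 - 2 * r * cos s + r\<^sup>2)"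
    using r by (intro mult_pos_pos poisson_denominator_pos)
qed

text \<open>This is Cauchy's formula at the point \<open>r\<close> for the function
  \<open>w \<mapsto> f w (1 - r\<^sup>2) / (1 - r w)\<close>, which has the same value as \<open>f\<close> at \<open>r\<close>. On the unit circle
  its denominator combines with that of the Cauchy kernel to a real number.\<close>

lemma poisson_formula:
  assumes contf: "continuous_on (cball 0 1) f" and holf: "f holomorphic_on ball 0 1"
    and r: "0 \<le> r" "r < 1"
  shows "((\<lambda>t. f (cis t) * of_real (poisson_kernel r t)) has_integral 2 * of_real pi * f (of_real r)) {0..2*pi}"
proof -
  let ?F = "\<lambda>w. f w * (1 - of_real r ^ 2) / (1 - of_real r * w)"
  have nz: "1 - of_real r * w \<noteq> 0" if "norm w \<le> 1" for w :: complex
  proof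
    assume "1 - of_real r * w = 0"
    then have "norm (of_real r * w) = 1" by (metis norm_one right_minus_eq)
    moreover have "r * norm w \<le> r * 1" using that r by (intro mult_left_mono) auto
    ultimately show False using r by (simp add: norm_mult)
  qed
  have "((\<lambda>u. ?F u / (u - of_real r)) has_contour_integral 2 * of_real pi * \<i> * ?F (of_real r)) (circlepath 0 1)"
  proof (rule Cauchy_integral_circlepath)
    show "continuous_on (cball 0 1) ?F"
      using nz by (intro continuous_intros contf) auto
    show "?F holomorphic_on ball 0 1"
      using nz by (intro holomorphic_intros holf) auto
  qed (use r in auto)
  moreover have "?F (of_real r) = f (of_real r)"
    using nz [of "of_real r"] r by (simp add: power2_eq_square)
  ultimately have "((\<lambda>t. ?F (cis t) / (cis t - of_real r) * \<i> * cis t) has_integral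
      2 * of_real pi * \<i> * f (of_real r)) {0..2*pi}"
    by (simp add: circlepath_def has_contour_integral_part_circlepath_iff)
  then have "((\<lambda>t. - \<i> * (?F (cis t) / (cis t - of_real r) * \<i> * cis t)) has_integral
      - \<i> * (2 * of_real pi * \<i> * f (of_real r))) {0..2*pi}"
    by (rule has_integral_mult_right)
  moreover have "- \<i> * (?F (cis t) / (cis t - of_real r) * \<i> * cis t) = f (cis t) * of_real (poisson_kernel r t)" for t
  proof -
    have 1: "cis t - of_real r = cis t * (1 - of_real r * cis (-t))"
      by (simp add: algebra_simps cis_mult)
    have "(1 - of_real r * cis t) * (1 - of_real r * cis (-t)) =
        1 - of_real r * (cis t + cis (-t)) + of_real r ^ 2 * (cis t * cis (-t))"
      by (simp only: algebra_simps power2_eq_square mult_1_left mult_1_right)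
    also have "\<dots> = of_real (1 - 2 * r * cos t + r\<^sup>2)"
    proof -
      have "cis t + cis (-t) = of_real (2 * cos t)" by (simp add: complex_eq_iff)
      then show ?thesis by (simp add: cis_mult)
    qed
    finally have 2: "(1 - of_real r * cis t) * (1 - of_real r * cis (-t)) = of_real (1 - 2 * r * cos t + r\<^sup>2)" .
    have "- \<i> * (X / y / (cis t * z) * \<i> * cis t) = X / (y * z)" for X y z :: complex
    proof -
      have "\<i> * (X * \<i>) = - X" by (simp add: complex_eq_iff)
      then show ?thesis by (simp add: cis_neq_zero)
    qed
    then have "- \<i> * (?F (cis t) / (cis t - of_real r) * \<i> * cis t) =
        f (cis t) * (1 - of_real r ^ 2) / ((1 - of_real r * cis t) * (1 - of_real r * cis (-t)))"
      unfolding 1 .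
    then show ?thesis
      unfolding 2 by (simp add: poisson_kernel_def)
  qed
  moreover have "- \<i> * (2 * of_real pi * \<i> * f (of_real r)) = 2 * of_real pi * f (of_real r)"
    by (simp add: complex_eq_iff)
  ultimately show ?thesis by (simp only:)
qed

lemma integral_fold_at_zero:
  fixes h :: "real \<Rightarrow> real"
  assumes "continuous_on UNIV h" "0 \<le> s"
  shows "integral {-s..s} h = integral {0..s} (\<lambda>t. h t + h (-t))"
proof -
  have cont: "continuous_on A h" for A using assms(1) continuous_on_subset by blast
  have cont': "continuous_on A (\<lambda>t. h (-t))" for A
    by (intro continuous_on_compose2 [OF assms(1)] continuous_intros) auto
  have "integral {-s..s} h = integral {-s..0} h + integral {0..s} h"
    using assms by (intro Henstock_Kurzweil_Integration.integral_combine [symmetric] integrable_continuous_interval cont) auto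
  also have "integral {-s..0} h = integral {0..s} (\<lambda>t. h (-t))"
    using Henstock_Kurzweil_Integration.integral_reflect_real [of s 0 "\<lambda>x. h (-x)"]
    by (simp only: minus_minus minus_zero)
  finally show ?thesis
    by (subst integral_add) (auto intro!: integrable_continuous_interval cont cont')
qed

lemma integral_periodic_shift:
  fixes h :: "real \<Rightarrow> real"
  assumes "continuous_on UNIV h" "\<And>t. h (t + 2 * pi) = h t"
  shows "integral {0..2*pi} h = integral {-pi..pi} h"
proof -
  have cont: "continuous_on A h" for A using assms(1) continuous_on_subset by blast
  have "integral {0..2*pi} h = integral {0..pi} h + integral {pi..2*pi} h"
    by (intro Henstock_Kurzweil_Integration.integral_combine [symmetric] integrable_continuous_interval cont) auto
  also have "integral {pi..2*pi} h = integral {-pi..0} h"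
    using integral_shift_Icc_real [of "-pi" 0 h "2 * pi"] assms(2) by (simp add: add.commute o_def)
  also have "integral {0..pi} h + integral {-pi..0} h = integral {-pi..pi} h"
    by (subst add.commute, intro Henstock_Kurzweil_Integration.integral_combine integrable_continuous_interval cont) auto
  finally show ?thesis .
qed

text \<open>The Poisson kernel is even and decreases on \<open>[0, \<pi>]\<close>, so it is an average of normalised
  indicator functions of symmetric intervals, and a bound on the means over all these intervals bounds
  the Poisson integral. The second mean value theorem replaces the layer decomposition of the kernel.\<close>

lemma norm_le_of_means_le:
  assumes contf: "continuous_on (cball 0 1) f" and holf: "f holomorphic_on ball 0 1"
    and r: "0 \<le> r" "r < 1"
    and le: "\<And>s. 0 < s \<Longrightarrow> s \<le> pi \<Longrightarrow> integral {-s..s} (\<lambda>t. norm (f (cis t))) \<le> 2 * \<mu> * s"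
  shows "norm (f (of_real r)) \<le> \<mu>"
proof -
  let ?P = "poisson_kernel r"
  define h where "h t = norm (f (cis t))" for t
  define g where "g t = h t + h (-t)" for t
  have conth: "continuous_on A h" for A
    unfolding h_def
    by (intro continuous_intros continuous_on_compose2 [OF contf]) auto
  have contg: "continuous_on A g" for A
    unfolding g_def by (intro continuous_intros conth continuous_on_compose2 [OF conth [of UNIV]]) auto
  have contfc: "continuous_on A (\<lambda>t. f (cis t))" for A
    by (intro continuous_on_compose2 [OF contf] continuous_intros) auto
  note contP = continuous_poisson_kernel [OF r]
  have even: "?P (-t) = ?P t" for t by (simp add: poisson_kernel_def)
  have fold: "integral {0..2*pi} (\<lambda>t. k t * ?P t) = integral {0..pi} (\<lambda>t. (k t + k (-t)) * ?P t)"
    if "\<And>A. continuous_on A k" "\<And>t. k (t + 2 * pi) = k t" for k :: "real \<Rightarrow> real"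
  proof -
    have "integral {0..2*pi} (\<lambda>t. k t * ?P t) = integral {-pi..pi} (\<lambda>t. k t * ?P t)"
      by (intro integral_periodic_shift continuous_intros that contP)
        (simp add: that poisson_kernel_def)
    also have "\<dots> = integral {0..pi} (\<lambda>t. k t * ?P t + k (-t) * ?P (-t))"
      by (intro integral_fold_at_zero continuous_intros that contP) simp
    finally show ?thesis by (simp add: even distrib_right)
  qed
  have "((\<lambda>t. 1 * complex_of_real (?P t)) has_integral 2 * of_real pi * 1) {0..2*pi}"
    by (intro poisson_formula r) auto
  then have "((\<lambda>t. Re (1 * complex_of_real (?P t))) has_integral Re (2 * of_real pi * 1)) {0..2*pi}"
    by (rule has_integral_Re)
  then have P: "2 * pi = integral {0..pi} (\<lambda>t. 2 * ?P t)"
    using fold [of "\<lambda>t. 1"] by (simp add: integral_unique)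
  have "norm (2 * of_real pi * f (of_real r)) \<le> integral {0..2*pi} (\<lambda>t. h t * ?P t)"
  proof -
    note int = poisson_formula [OF contf holf r]
    have "norm (integral {0..2*pi} (\<lambda>t. f (cis t) * of_real (?P t))) \<le> integral {0..2*pi} (\<lambda>t. h t * ?P t)"
      using int poisson_kernel_nonneg [OF r]
      by (intro integral_norm_bound_integral integrable_continuous_interval continuous_intros conth contfc contP)
        (auto simp: h_def norm_mult)
    then show ?thesis using int by (simp add: integral_unique)
  qed
  also have "\<dots> = integral {0..pi} (\<lambda>t. g t * ?P t)"
    unfolding g_def by (rule fold) (use conth in \<open>auto simp: h_def cis_conv_exp algebra_simps exp_add\<close>)
  also have "\<dots> \<le> integral {0..pi} (\<lambda>t. 2 * \<mu> * ?P t)"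
  proof -
    define d where "d t = 2 * \<mu> - g t" for t
    have contd: "continuous_on A d" for A unfolding d_def by (intro continuous_intros contg)
    have D: "0 \<le> integral {0..s} d" if "0 \<le> s" "s \<le> pi" for s
    proof (cases "s = 0")
      case False
      have "integral {0..s} g = integral {-s..s} h"
        using integral_fold_at_zero [OF conth, of s] that by (simp add: g_def [abs_def])
      then have "integral {0..s} g \<le> 2 * \<mu> * s"
        using le [of s] False that by (simp add: h_def [abs_def])
      moreover have "integral {0..s} d = 2 * \<mu> * s - integral {0..s} g"
        unfolding d_def using that
        by (subst integral_diff) (auto intro!: integrable_continuous_interval contg)
      ultimately show ?thesis by simp
    qed simp
    obtain c where c: "c \<in> {0..pi}" "((\<lambda>t. (- ?P t) * d t) has_integral
        ((- ?P 0) * integral {0..c} d + (- ?P pi) * integral {c..pi} d)) {0..pi}"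
      by (rule second_mean_value_theorem_full [of d 0 pi "\<lambda>t. - ?P t"])
        (use poisson_kernel_antimono [OF r] contd in \<open>auto intro: integrable_continuous_interval\<close>)
    have "integral {0..c} d + integral {c..pi} d = integral {0..pi} d"
      using c by (intro Henstock_Kurzweil_Integration.integral_combine integrable_continuous_interval contd) auto
    then have split: "(- ?P 0) * integral {0..c} d + (- ?P pi) * integral {c..pi} d =
        - ((?P 0 - ?P pi) * integral {0..c} d + ?P pi * integral {0..pi} d)"
      by (simp add: algebra_simps flip: distrib_left)
    have "0 \<le> (?P 0 - ?P pi) * integral {0..c} d + ?P pi * integral {0..pi} d"
      using D c poisson_kernel_antimono [OF r, of 0 pi] poisson_kernel_nonneg [OF r]
      by (intro add_nonneg_nonneg mult_nonneg_nonneg) auto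
    then have "integral {0..pi} (\<lambda>t. (- ?P t) * d t) \<le> 0"
      unfolding integral_unique [OF c(2)] split by simp
    moreover have "integral {0..pi} (\<lambda>t. (- ?P t) * d t) =
        integral {0..pi} (\<lambda>t. g t * ?P t) - integral {0..pi} (\<lambda>t. 2 * \<mu> * ?P t)"
      by (subst integral_diff [symmetric])
        (auto intro!: integrable_continuous_interval continuous_intros contg contP integral_cong
          simp: d_def algebra_simps)
    ultimately show ?thesis by simp
  qed
  also have "\<dots> = 2 * pi * \<mu>"
    unfolding P by (simp add: mult_ac)
  finally show ?thesis by (simp add: norm_mult)
qed

section \<open>The maximal function\<close>

text \<open>Among the intervals on which the mean of \<open>h\<close> exceeds \<open>l\<close>, Vitali's lemma selects disjoint ones
  whose fivefold enlargements cover \<open>E\<close>; hence the factor 5. The intervals are centred in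
  \<open>[0, 2 \<pi>]\<close> and have radius at most \<open>\<pi>\<close>, so the disjoint ones lie in \<open>[-\<pi>, 3 \<pi>]\<close>.\<close>

lemma maximal_function_weak_type:
  fixes h :: "real \<Rightarrow> real"
  assumes cont: "continuous_on UNIV h" and nonneg: "\<And>t. 0 \<le> h t" and l: "0 < l"
  defines "E \<equiv> {\<theta>\<in>{0..2*pi}. \<exists>s. 0 < s \<and> s \<le> pi \<and> 2 * l * s < integral {\<theta>-s..\<theta>+s} h}"
  obtains U where "E \<subseteq> U" "U \<in> lmeasurable" "measure lebesgue U \<le> 5 / l * integral {-pi..3*pi} h"
proof -
  define K where "K = {(\<theta>, s). \<theta> \<in> {0..2*pi} \<and> 0 < s \<and> s \<le> pi \<and> 2 * l * s < integral {\<theta>-s..\<theta>+s} h}"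
  have int: "h integrable_on {a..b}" for a b
    by (rule integrable_continuous_interval) (rule continuous_on_subset [OF cont], simp)
  have sub: "E \<subseteq> (\<Union>i\<in>K. cball (fst i) (snd i))"
  proof
    fix \<theta> assume "\<theta> \<in> E"
    then obtain s where "(\<theta>, s) \<in> K" "0 < s" unfolding E_def K_def by blast
    then show "\<theta> \<in> (\<Union>i\<in>K. cball (fst i) (snd i))" by (intro UN_I [of "(\<theta>, s)"]) auto
  qed
  have pos: "0 < snd i \<and> snd i \<le> pi" if "i \<in> K" for i
    using that unfolding K_def by force
  obtain C where C: "countable C" "C \<subseteq> K"
     "pairwise (\<lambda>i j. disjnt (cball (fst i) (snd i)) (cball (fst j) (snd j))) C"
     "E \<subseteq> (\<Union>i\<in>C. cball (fst i) (5 * snd i))"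
    using Vitali_covering_lemma_cballs [OF sub pos] by blast
  let ?B = "5 / l * integral {-pi..3*pi} h"
  have bound: "measure lebesgue (\<Union>i\<in>F. cball (fst i) (5 * snd i)) \<le> ?B" if F: "F \<subseteq> C" "finite F" for F
  proof -
    have mem: "0 < snd i" "cball (fst i) (snd i) \<subseteq> {-pi..3*pi}"
        "2 * l * snd i < integral (cball (fst i) (snd i)) h" if "i \<in> F" for i
    proof -
      obtain \<theta> s where i: "i = (\<theta>, s)" by (cases i)
      then have "(\<theta>, s) \<in> K" using that F C(2) by blast
      then have s: "\<theta> \<in> {0..2*pi}" "0 < s" "s \<le> pi" "2 * l * s < integral {\<theta>-s..\<theta>+s} h"
        unfolding K_def by blast+
      then show "0 < snd i" "cball (fst i) (snd i) \<subseteq> {-pi..3*pi}"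
        "2 * l * snd i < integral (cball (fst i) (snd i)) h"
        unfolding i cball_eq_atLeastAtMost fst_conv snd_conv by (simp, force, simp)
    qed
    have disjoint_integrals: "(\<Sum>i\<in>F. integral (cball (fst i) (snd i)) h) \<le> integral {-pi..3*pi} h"
    proof (rule has_integral_subset_le)
      show "(h has_integral (\<Sum>i\<in>F. integral (cball (fst i) (snd i)) h)) (\<Union>i\<in>F. cball (fst i) (snd i))"
      proof (rule has_integral_UN)
        show "(h has_integral integral (cball (fst i) (snd i)) h) (cball (fst i) (snd i))" for i
          by (simp add: cball_eq_atLeastAtMost int integrable_integral)
        show "pairwise (\<lambda>i j. negligible (cball (fst i) (snd i) \<inter> cball (fst j) (snd j))) F"
          by (rule pairwise_mono [OF C(3) _ F(1)]) (simp add: disjnt_def)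
      qed (use F in auto)
    next
      show "(h has_integral integral {-pi..3*pi} h) {-pi..3*pi}"
        using int by (rule integrable_integral)
      show "(\<Union>i\<in>F. cball (fst i) (snd i)) \<subseteq> {-pi..3*pi}"
        using mem(2) by blast
    qed (use nonneg in simp)
    have "measure lebesgue (\<Union>i\<in>F. cball (fst i) (5 * snd i)) \<le> (\<Sum>i\<in>F. measure lebesgue (cball (fst i) (5 * snd i)))"
      using F by (intro measure_UNION_le) auto
    also have "\<dots> = (\<Sum>i\<in>F. 10 * snd i)"
      using mem by (intro sum.cong) (auto simp: cball_eq_atLeastAtMost less_imp_le)
    also have "\<dots> \<le> (\<Sum>i\<in>F. 5 / l * integral (cball (fst i) (snd i)) h)"
    proof (intro sum_mono)
      fix i assume "i \<in> F"
      then have "2 * l * snd i \<le> integral (cball (fst i) (snd i)) h"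
        using mem(3) by (simp add: less_imp_le)
      then show "10 * snd i \<le> 5 / l * integral (cball (fst i) (snd i)) h"
        using l by (simp add: field_simps)
    qed
    also have "\<dots> = 5 / l * (\<Sum>i\<in>F. integral (cball (fst i) (snd i)) h)"
      by (simp add: sum_distrib_left)
    also have "\<dots> \<le> ?B"
      using disjoint_integrals l by (intro mult_left_mono) auto
    finally show ?thesis .
  qed
  show thesis
  proof (rule that)
    show "(\<Union>i\<in>C. cball (fst i) (5 * snd i)) \<in> lmeasurable"
      by (rule fmeasurable_UN_bound [OF C(1) _ bound]) simp_all
    show "measure lebesgue (\<Union>i\<in>C. cball (fst i) (5 * snd i)) \<le> ?B"
      by (rule measure_UN_bound [OF C(1) _ bound]) simp_all
  qed (rule C)
qed

text \<open>The supremum over a whole radius is controlled by the maximal function of a single circle as long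
  as the radius ends before that circle. The resulting bounds are uniform in the circle, and the
  exceptional sets increase as the circles approach the boundary.\<close>

lemma radial_weak_type:
  assumes holg: "g holomorphic_on ball 0 1" and l: "0 < l"
    and bound: "\<And>\<rho>. 0 < \<rho> \<Longrightarrow> \<rho> < 1 \<Longrightarrow> integral {-pi..3*pi} (\<lambda>t. norm (g (of_real \<rho> * cis t))) \<le> B"
  obtains U where "{\<theta>\<in>{0..2*pi}. \<exists>r. 0 \<le> r \<and> r < 1 \<and> l < norm (g (of_real r * cis \<theta>))} \<subseteq> U"
    "U \<in> lmeasurable" "measure lebesgue U \<le> 5 / l * B"
proof -
  define V where "V = (\<lambda>\<rho>::real. {\<theta>\<in>{0..2*pi}. \<exists>r. 0 \<le> r \<and> r < \<rho> \<and> l < norm (g (of_real r * cis \<theta>))})"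
  define \<rho> where "\<rho> = (\<lambda>n::nat. 1 - 1 / real (Suc (Suc n)))"
  have \<rho>: "0 < \<rho> n" "\<rho> n < 1" for n by (auto simp: \<rho>_def field_simps)
  have in_disk: "of_real r * cis t \<in> ball 0 1" if "0 \<le> r" "r < 1" for r t
    using that by (simp add: norm_mult)
  have contg: "continuous_on A (\<lambda>t. g (of_real r * cis t))" if "0 \<le> r" "r < 1" for r A
    by (intro continuous_on_compose2 [OF holomorphic_on_imp_continuous_on [OF holg]] continuous_intros)
      (use in_disk that in auto)
  have V: "V (\<rho> n) \<in> lmeasurable \<and> measure lebesgue (V (\<rho> n)) \<le> 5 / l * B" for n
  proof -
    let ?h = "\<lambda>t. norm (g (of_real (\<rho> n) * cis t))"
    have open_V: "open {\<theta>. l < norm (g (of_real r * cis \<theta>))}" if "0 \<le> r" "r < \<rho> n" for r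
      using that \<rho> [of n] by (intro open_Collect_less continuous_intros contg) auto
    have "V (\<rho> n) = {0..2*pi} \<inter> (\<Union>r\<in>{0..<\<rho> n}. {\<theta>. l < norm (g (of_real r * cis \<theta>))})"
      by (auto simp: V_def)
    moreover have "open (\<Union>r\<in>{0..<\<rho> n}. {\<theta>. l < norm (g (of_real r * cis \<theta>))})"
      using open_V by (intro open_UN) auto
    ultimately have lm: "V (\<rho> n) \<in> lmeasurable"
      by (simp add: fmeasurable_Int_fmeasurable lmeasurable_interval)
    obtain U where U: "{\<theta>\<in>{0..2*pi}. \<exists>s. 0 < s \<and> s \<le> pi \<and> 2 * l * s < integral {\<theta>-s..\<theta>+s} ?h} \<subseteq> U"
      "U \<in> lmeasurable" "measure lebesgue U \<le> 5 / l * integral {-pi..3*pi} ?h"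
      by (rule maximal_function_weak_type [of ?h l]) (use \<rho> [of n] l in \<open>auto intro!: continuous_intros contg\<close>)
    have "V (\<rho> n) \<subseteq> {\<theta>\<in>{0..2*pi}. \<exists>s. 0 < s \<and> s \<le> pi \<and> 2 * l * s < integral {\<theta>-s..\<theta>+s} ?h}"
    proof
      fix \<theta> assume "\<theta> \<in> V (\<rho> n)"
      then obtain r where \<theta>: "\<theta> \<in> {0..2*pi}" and r: "0 \<le> r" "r < \<rho> n" "l < norm (g (of_real r * cis \<theta>))"
        unfolding V_def by blast
      have "\<exists>s. 0 < s \<and> s \<le> pi \<and> 2 * l * s < integral {\<theta>-s..\<theta>+s} ?h"
      proof (rule ccontr)
        assume "\<not> ?thesis"
        then have le: "\<And>s. 0 < s \<Longrightarrow> s \<le> pi \<Longrightarrow> integral {\<theta>-s..\<theta>+s} ?h \<le> 2 * l * s"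
          using not_less by blast
        let ?f = "\<lambda>w. g (of_real (\<rho> n) * cis \<theta> * w)"
        have disk: "of_real (\<rho> n) * cis \<theta> * w \<in> ball 0 1" if "norm w \<le> 1" for w
        proof -
          have "\<rho> n * norm w \<le> \<rho> n * 1" using that \<rho> [of n] by (intro mult_left_mono) auto
          then have "\<rho> n * norm w < 1" using \<rho> [of n] by linarith
          then show ?thesis using \<rho> [of n] by (simp add: norm_mult)
        qed
        have "norm (?f (of_real (r / \<rho> n))) \<le> l"
        proof (rule norm_le_of_means_le)
          show "continuous_on (cball 0 1) ?f"
            by (intro continuous_on_compose2 [OF holomorphic_on_imp_continuous_on [OF holg]] continuous_intros)
              (use disk in auto)
          show "?f holomorphic_on ball 0 1"
            by (rule holomorphic_on_compose_gen [OF _ holg, unfolded o_def])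
              (use disk in \<open>auto intro!: holomorphic_intros\<close>)
          fix s :: real assume s: "0 < s" "s \<le> pi"
          have "integral {-s..s} (\<lambda>t. norm (?f (cis t))) = integral {-s..s} (\<lambda>t. ?h (t + \<theta>))"
            by (simp add: mult.assoc cis_mult add.commute)
          also have "\<dots> = integral {\<theta>-s..\<theta>+s} ?h"
            using integral_shift_Icc_real [of "-s" s ?h \<theta>] by (simp add: o_def add.commute)
          finally show "integral {-s..s} (\<lambda>t. norm (?f (cis t))) \<le> 2 * l * s"
            using le [OF s] by simp
        qed (use r \<rho> [of n] in auto)
        moreover have "?f (of_real (r / \<rho> n)) = g (of_real r * cis \<theta>)"
          using \<rho> [of n] by (simp add: mult_ac)
        ultimately show False using r by simp
      qed
      then show "\<theta> \<in> {\<theta>\<in>{0..2*pi}. \<exists>s. 0 < s \<and> s \<le> pi \<and> 2 * l * s < integral {\<theta>-s..\<theta>+s} ?h}"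
        using \<theta> by blast
    qed
    then have "measure lebesgue (V (\<rho> n)) \<le> measure lebesgue U"
      using U lm by (intro measure_mono_fmeasurable) auto
    also have "\<dots> \<le> 5 / l * B"
    proof -
      have "5 / l * integral {-pi..3*pi} ?h \<le> 5 / l * B"
        using l by (intro mult_left_mono bound \<rho>) auto
      then show ?thesis using U(3) by linarith
    qed
    finally show ?thesis using lm by simp
  qed
  have mono: "V (\<rho> m) \<subseteq> V (\<rho> n)" if "m \<le> n" for m n
  proof -
    have "\<rho> m \<le> \<rho> n" using that by (simp add: \<rho>_def frac_le)
    then show ?thesis unfolding V_def by (smt (verit) Collect_mono)
  qed
  have "(\<Union>i\<le>n. V (\<rho> i)) = V (\<rho> n)" for n using mono by auto
  then have *: "\<And>n. measure lebesgue (\<Union>i\<le>n. V (\<rho> i)) \<le> 5 / l * B" using V by simp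
  show thesis
  proof (rule that)
    show "(\<Union>n. V (\<rho> n)) \<in> lmeasurable" "measure lebesgue (\<Union>n. V (\<rho> n)) \<le> 5 / l * B"
      using V * by (auto intro: fmeasurable_countable_Union measure_countable_Union_le)
    show "{\<theta>\<in>{0..2*pi}. \<exists>r. 0 \<le> r \<and> r < 1 \<and> l < norm (g (of_real r * cis \<theta>))} \<subseteq> (\<Union>n. V (\<rho> n))"
    proof clarsimp
      fix \<theta> r :: real assume *: "0 \<le> \<theta>" "\<theta> \<le> 2 * pi" "0 \<le> r" "r < 1" "l < norm (g (of_real r * cis \<theta>))"
      obtain n where "1 / real (Suc n) < 1 - r" using \<open>r < 1\<close> by (metis diff_gt_0_iff_gt nat_approx_posE)
      moreover have "1 / real (Suc (Suc n)) \<le> 1 / real (Suc n)" by (simp add: frac_le)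
      ultimately have "r < \<rho> n" by (simp add: \<rho>_def)
      then show "\<exists>n. \<theta> \<in> V (\<rho> n)" using * by (auto simp: V_def)
    qed
  qed
qed

section \<open>Approximation in mean square\<close>

lemma has_integral_cis:
  assumes "m \<noteq> 0"
  shows "((\<lambda>t. cis (of_int m * t)) has_integral 0) {-pi..3*pi}"
proof -
  define F where "F = (\<lambda>t::real. exp (\<i> * of_int m * of_real t) / (\<i> * of_int m))"
  have "((\<lambda>t. cis (of_int m * t)) has_integral (F (3*pi) - F (-pi))) {-pi..3*pi}"
  proof (rule fundamental_theorem_of_calculus)
    fix t :: real
    have "((\<lambda>w. exp (\<i> * of_int m * w) / (\<i> * of_int m)) has_field_derivative exp (\<i> * of_int m * of_real t)) (at (of_real t))"
      using assms by (auto intro!: derivative_eq_intros)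
    then have "((\<lambda>t. exp (\<i> * of_int m * of_real t) / (\<i> * of_int m)) has_vector_derivative exp (\<i> * of_int m * of_real t)) (at t within {-pi..3*pi})"
      by (rule has_vector_derivative_real_field)
    then show "(F has_vector_derivative cis (of_int m * t)) (at t within {-pi..3*pi})"
      by (simp add: F_def cis_conv_exp mult_ac)
  qed simp
  moreover have "F (3*pi) = F (-pi)"
  proof -
    have "exp (\<i> * of_int m * of_real (3*pi)) = exp (\<i> * of_int m * of_real (-pi))"
      unfolding exp_eq by (intro exI [of _ "2 * m"]) (simp add: algebra_simps)
    then show ?thesis by (simp add: F_def)
  qed
  ultimately show ?thesis by simp
qed

lemma parseval_finite:
  fixes c :: "nat \<Rightarrow> complex"
  assumes "finite A"
  shows "integral {-pi..3*pi} (\<lambda>t. (norm (\<Sum>k\<in>A. c k * cis (real k * t)))\<^sup>2) = 4 * pi * (\<Sum>k\<in>A. (norm (c k))\<^sup>2)"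
proof -
  let ?J = "{-pi..3*pi}"
  have orthogonal: "((\<lambda>t. c j * cnj (c k) * cis (of_int (int j - int k) * t)) has_integral
      (if j = k then of_real (4 * pi * (norm (c k))\<^sup>2) else 0)) ?J" for j k
  proof (cases "j = k")
    case True
    have "((\<lambda>t. c k * cnj (c k)) has_integral (measure lborel ?J *\<^sub>R (c k * cnj (c k)))) ?J"
      using has_integral_const_real [of "c k * cnj (c k)" "-pi" "3*pi"] by simp
    moreover have "measure lborel ?J *\<^sub>R (c k * cnj (c k)) = of_real (4 * pi * (norm (c k))\<^sup>2)"
      unfolding complex_norm_square [symmetric] by (simp add: scaleR_conv_of_real)
    ultimately show ?thesis using True by simp
  next
    case False
    then have "((\<lambda>t. c j * cnj (c k) * cis (of_int (int j - int k) * t)) has_integral (c j * cnj (c k) * 0)) ?J"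
      by (intro has_integral_mult_right has_integral_cis) auto
    then show ?thesis using False by simp
  qed
  have "((\<lambda>t. \<Sum>j\<in>A. \<Sum>k\<in>A. c j * cnj (c k) * cis (of_int (int j - int k) * t)) has_integral
      (\<Sum>j\<in>A. \<Sum>k\<in>A. if j = k then of_real (4 * pi * (norm (c k))\<^sup>2) else 0)) ?J"
    using assms by (intro has_integral_sum orthogonal)
  moreover have "(\<Sum>j\<in>A. \<Sum>k\<in>A. if j = k then of_real (4 * pi * (norm (c k))\<^sup>2) else 0)
      = complex_of_real (4 * pi * (\<Sum>k\<in>A. (norm (c k))\<^sup>2))"
    using assms by (simp add: sum_distrib_left)
  moreover have "(\<Sum>j\<in>A. \<Sum>k\<in>A. c j * cnj (c k) * cis (of_int (int j - int k) * t)) =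
      complex_of_real ((norm (\<Sum>k\<in>A. c k * cis (real k * t)))\<^sup>2)" for t
    unfolding complex_norm_square cnj_sum sum_product
    by (intro sum.cong refl) (simp add: cis_cnj cis_mult algebra_simps)
  ultimately have "((\<lambda>t. complex_of_real ((norm (\<Sum>k\<in>A. c k * cis (real k * t)))\<^sup>2)) has_integral
      complex_of_real (4 * pi * (\<Sum>k\<in>A. (norm (c k))\<^sup>2))) ?J"
    by (simp only:)
  from has_integral_Re [OF this] show ?thesis
    by (intro integral_unique) simp
qed

text \<open>The Taylor series converges uniformly on the circle of radius \<open>\<rho>\<close>, so the orthogonality of
  the exponentials passes from partial sums to remainders.\<close>

lemma parseval_tail:
  assumes holf: "f holomorphic_on ball 0 1" and \<rho>: "0 < \<rho>" "\<rho> < 1"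
  defines "a \<equiv> \<lambda>k. (deriv ^^ k) f 0 / fact k"
  shows "(\<lambda>M. 4 * pi * (\<Sum>k=N..<M. (norm (a k))\<^sup>2 * \<rho> ^ (2 * k))) \<longlonglongrightarrow>
    integral {-pi..3*pi} (\<lambda>t. (norm (f (of_real \<rho> * cis t) - (\<Sum>k<N. a k * (of_real \<rho> * cis t) ^ k)))\<^sup>2)"
proof -
  let ?J = "{-pi..3*pi}"
  define s where "s = (\<lambda>M z. \<Sum>k<M. a k * z ^ k)"
  define z where "z = (\<lambda>t. complex_of_real \<rho> * cis t)"
  have sums: "(\<lambda>k. a k * w ^ k) sums f w" if "norm w < 1" for w
    using holomorphic_power_series [OF holf, of w] that by (simp add: a_def)
  have "conv_radius a \<ge> 1"
  proof (rule conv_radius_geI_ex)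
    fix r :: real assume "0 < r" "ereal r < 1"
    then show "\<exists>w. norm w = r \<and> summable (\<lambda>n. a n * w ^ n)"
      using sums [of "of_real r"] by (intro exI [of _ "of_real r"]) (auto simp: sums_iff)
  qed
  moreover have "ereal \<rho> < 1"
    using \<rho> by (simp add: one_ereal_def)
  ultimately have "ereal \<rho> < conv_radius a"
    by (rule less_le_trans [rotated])
  then have ul0: "uniform_limit (cball 0 \<rho>) (\<lambda>n x. \<Sum>i<n. a i * (x - 0) ^ i) (\<lambda>x. suminf (\<lambda>i. a i * (x - 0) ^ i)) sequentially"
    by (rule powser_uniform_limit)
  have "uniform_limit (cball 0 \<rho>) s f sequentially"
  proof (rule uniform_limit_cong [THEN iffD1, OF _ _ ul0])
    show "suminf (\<lambda>i. a i * (x - 0) ^ i) = f x" if "x \<in> cball 0 \<rho>" for x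
      using sums [of x] that \<rho> by (auto simp: sums_iff)
  qed (simp add: s_def)
  then have "uniform_limit ?J (\<lambda>M t. s M (z t)) (\<lambda>t. f (z t)) sequentially"
    by (rule uniform_limit_compose') (use \<rho> in \<open>auto simp: z_def norm_mult\<close>)
  then have ul: "uniform_limit ?J (\<lambda>M t. norm (s M (z t) - s N (z t))) (\<lambda>t. norm (f (z t) - s N (z t))) sequentially"
    by (intro uniform_limit_intros)
  have zin: "norm (z t) < 1" for t using \<rho> by (simp add: z_def norm_mult)
  have contz: "continuous_on S z" for S unfolding z_def by (intro continuous_intros)
  have contfz: "continuous_on S (\<lambda>t. f (z t))" for S
    by (rule continuous_on_compose2 [OF holomorphic_on_imp_continuous_on [OF holf] contz]) (use zin in auto)
  have conts: "continuous_on S (\<lambda>t. s M (z t))" for S M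
    unfolding s_def by (intro continuous_intros contz)
  have bdd: "bounded ((\<lambda>t. norm (f (z t) - s N (z t))) ` ?J)"
    by (intro compact_imp_bounded compact_continuous_image continuous_intros contfz conts) auto
  have "uniform_limit ?J (\<lambda>M t. (norm (s M (z t) - s N (z t)))\<^sup>2) (\<lambda>t. (norm (f (z t) - s N (z t)))\<^sup>2) sequentially"
    unfolding power2_eq_square by (rule uniform_lim_mult [OF ul ul bdd bdd])
  then obtain I J where I: "\<And>M. ((\<lambda>t. (norm (s M (z t) - s N (z t)))\<^sup>2) has_integral I M) ?J"
    "((\<lambda>t. (norm (f (z t) - s N (z t)))\<^sup>2) has_integral J) ?J" "I \<longlonglongrightarrow> J"
    by (rule uniform_limit_integral) (auto intro!: continuous_intros conts)
  have "\<forall>\<^sub>F M in sequentially. I M = 4 * pi * (\<Sum>k=N..<M. (norm (a k))\<^sup>2 * \<rho> ^ (2 * k))"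
    using eventually_ge_at_top [of N]
  proof eventually_elim
    case (elim M)
    have "s M (z t) - s N (z t) = (\<Sum>k=N..<M. (a k * of_real \<rho> ^ k) * cis (real k * t))" for t
    proof -
      have "s M (z t) = s N (z t) + (\<Sum>k=N..<M. a k * z t ^ k)"
        unfolding s_def lessThan_atLeast0 using elim by (simp add: sum.atLeastLessThan_concat)
      then show ?thesis
        by (simp add: z_def power_mult_distrib Complex.DeMoivre mult.assoc)
    qed
    then have "I M = integral ?J (\<lambda>t. (norm (\<Sum>k=N..<M. (a k * of_real \<rho> ^ k) * cis (real k * t)))\<^sup>2)"
      using integral_unique [OF I(1) [of M]] by simp
    also have "\<dots> = 4 * pi * (\<Sum>k=N..<M. (norm (a k * of_real \<rho> ^ k))\<^sup>2)"
      by (rule parseval_finite) simp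
    also have "(\<Sum>k=N..<M. (norm (a k * of_real \<rho> ^ k))\<^sup>2) = (\<Sum>k=N..<M. (norm (a k))\<^sup>2 * \<rho> ^ (2 * k))"
      using \<rho> by (simp add: norm_mult norm_power power_mult_distrib power_even_eq)
    finally show ?case .
  qed
  from Lim_transform_eventually [OF I(3) this] have "(\<lambda>M. 4 * pi * (\<Sum>k=N..<M. (norm (a k))\<^sup>2 * \<rho> ^ (2 * k))) \<longlonglongrightarrow> J" .
  then show ?thesis
    unfolding integral_unique [OF I(2), symmetric] by (simp only: s_def z_def)
qed

text \<open>Boundedness of \<open>f\<close> makes the Taylor coefficients square summable. A tail of the sum of their
  squares bounds the mean square error of a Taylor polynomial on all circles at once.\<close>

lemma polynomial_approximation_in_mean:
  assumes holf: "f holomorphic_on ball 0 1" and bound: "\<And>z. norm z < 1 \<Longrightarrow> norm (f z) \<le> B" and e: "0 < e"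
  obtains p where "p holomorphic_on UNIV"
    "\<And>\<rho>. 0 < \<rho> \<Longrightarrow> \<rho> < 1 \<Longrightarrow>
      integral {-pi..3*pi} (\<lambda>t. (norm (f (of_real \<rho> * cis t) - p (of_real \<rho> * cis t)))\<^sup>2) \<le> e"
proof -
  let ?J = "{-pi..3*pi}"
  define a where "a = (\<lambda>k. (deriv ^^ k) f 0 / fact k)"
  have lim: "(\<lambda>M. 4 * pi * (\<Sum>k=N..<M. (norm (a k))\<^sup>2 * \<rho> ^ (2 * k))) \<longlonglongrightarrow>
      integral ?J (\<lambda>t. (norm (f (of_real \<rho> * cis t) - (\<Sum>k<N. a k * (of_real \<rho> * cis t) ^ k)))\<^sup>2)"
    if "0 < \<rho>" "\<rho> < 1" for N \<rho>
    using parseval_tail [OF holf that] by (simp only: a_def)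
  have inc: "(\<Sum>k=N..<M. (norm (a k))\<^sup>2 * \<rho> ^ (2 * k)) \<le> (\<Sum>k=N..<M'. (norm (a k))\<^sup>2 * \<rho> ^ (2 * k))"
    if "M \<le> M'" "0 < \<rho>" for N M M' and \<rho> :: real
    using that by (intro sum_mono2) auto
  have le: "(\<Sum>k<M. (norm (a k))\<^sup>2) \<le> B\<^sup>2" for M
  proof -
    have "(\<Sum>k<M. (norm (a k))\<^sup>2 * \<rho> ^ (2 * k)) \<le> B\<^sup>2" if \<rho>: "0 < \<rho>" "\<rho> < 1" for \<rho>
    proof -
      have "4 * pi * (\<Sum>k=0..<M. (norm (a k))\<^sup>2 * \<rho> ^ (2 * k)) \<le> integral ?J (\<lambda>t. (norm (f (of_real \<rho> * cis t)))\<^sup>2)"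
        using lim [OF \<rho>, of 0] inc [of M _ \<rho> 0] \<rho>
        by (intro LIMSEQ_le_const [of "\<lambda>M. 4 * pi * (\<Sum>k=0..<M. (norm (a k))\<^sup>2 * \<rho> ^ (2 * k))"])
          (auto intro!: exI [of _ M] mult_left_mono)
      also have "\<dots> \<le> integral ?J (\<lambda>t. B\<^sup>2)"
      proof (rule integral_le)
        have "continuous_on ?J (\<lambda>t. f (of_real \<rho> * cis t))"
          by (intro continuous_on_compose2 [OF holomorphic_on_imp_continuous_on [OF holf]] continuous_intros)
            (use \<rho> in \<open>auto simp: norm_mult\<close>)
        then show "(\<lambda>t. (norm (f (of_real \<rho> * cis t)))\<^sup>2) integrable_on ?J"
          by (intro integrable_continuous_interval continuous_intros)
        show "(norm (f (of_real \<rho> * cis t)))\<^sup>2 \<le> B\<^sup>2" for t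
          using \<rho> by (intro power_mono bound) (auto simp: norm_mult)
      qed auto
      also have "\<dots> = 4 * pi * B\<^sup>2" by simp
      finally show ?thesis by (simp add: atLeast0LessThan)
    qed
    then have ev: "\<forall>\<^sub>F \<rho> in at_left 1. (\<Sum>k<M. (norm (a k))\<^sup>2 * \<rho> ^ (2 * k)) \<le> B\<^sup>2"
      using eventually_at_left_real [of 0 1] by (auto elim!: eventually_mono)
    have "((\<lambda>\<rho>. \<Sum>k<M. (norm (a k))\<^sup>2 * \<rho> ^ (2 * k)) \<longlongrightarrow> (\<Sum>k<M. (norm (a k))\<^sup>2 * 1 ^ (2 * k))) (at_left 1)"
      by (intro tendsto_intros)
    from tendsto_upperbound [OF this ev] show ?thesis by simp
  qed
  have sum: "summable (\<lambda>k. (norm (a k))\<^sup>2)"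
    using le by (intro summableI_nonneg_bounded) auto
  obtain N where N: "norm (\<Sum>k. (norm (a (k + N)))\<^sup>2) < e / (4 * pi)"
    using suminf_exist_split [OF _ sum, of "e / (4 * pi)"] e by auto
  have "integral ?J (\<lambda>t. (norm (f (of_real \<rho> * cis t) - (\<Sum>k<N. a k * (of_real \<rho> * cis t) ^ k)))\<^sup>2) \<le> e"
    if \<rho>: "0 < \<rho>" "\<rho> < 1" for \<rho>
  proof (rule LIMSEQ_le_const2 [OF lim [OF \<rho>]], intro exI allI impI)
    fix M
    have "(\<Sum>k=N..<M. (norm (a k))\<^sup>2 * \<rho> ^ (2 * k)) \<le> (\<Sum>k=N..<M. (norm (a k))\<^sup>2)"
      using \<rho> by (intro sum_mono mult_left_le) (auto intro!: power_le_one)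
    also have "\<dots> = (\<Sum>k<M-N. (norm (a (k + N)))\<^sup>2)"
      by (rule sum.reindex_bij_witness [of _ "\<lambda>k. k + N" "\<lambda>k. k - N"]) auto
    also have "\<dots> \<le> (\<Sum>k. (norm (a (k + N)))\<^sup>2)"
      using sum by (intro sum_le_suminf summable_ignore_initial_segment [of "\<lambda>k. (norm (a k))\<^sup>2"]) auto
    also have "\<dots> \<le> e / (4 * pi)" using N by simp
    finally show "4 * pi * (\<Sum>k=N..<M. (norm (a k))\<^sup>2 * \<rho> ^ (2 * k)) \<le> e"
      by (simp add: field_simps)
  qed
  then show thesis
    by (intro that [of "\<lambda>z. \<Sum>k<N. a k * z ^ k"]) (auto intro!: holomorphic_intros)
qed

section \<open>Fatou's theorem\<close>

text \<open>An angle is bad at level \<open>j\<close> if no entire function stays close to \<open>f\<close> along the whole radius.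
  For a polynomial \<open>p\<close> close to \<open>f\<close> in mean square, the weak type estimate, applied to the analytic
  function \<open>(f - p)\<^sup>2\<close>, covers the bad angles by a set of small measure. The square turns a mean
  square bound into a bound on the mean of the modulus. Along a radius that is good at all levels, \<open>f\<close> is a uniform limit of
  functions that are continuous up to the end point, and so it has a limit there.\<close>

theorem fatou_radial_limits:
  assumes holf: "f holomorphic_on ball 0 1" and bound: "\<And>z. norm z < 1 \<Longrightarrow> norm (f z) \<le> B"
  shows "negligible {\<theta>\<in>{0..2*pi}. \<not> (\<exists>L. ((\<lambda>r. f (of_real r * cis \<theta>)) \<longlongrightarrow> L) (at_left 1))}"
proof -
  define bad where "bad = (\<lambda>j::nat. {\<theta>\<in>{0..2*pi}. \<forall>p. p holomorphic_on UNIV \<longrightarrow>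
      (\<exists>r. 0 \<le> r \<and> r < 1 \<and> 1 / real (Suc j) < norm ((f (of_real r * cis \<theta>) - p (of_real r * cis \<theta>))\<^sup>2))})"
  have "negligible (bad j)" for j
    unfolding negligible_outer_le
  proof (intro allI impI)
    fix e :: real assume e: "0 < e"
    then have "0 < e / (5 * real (Suc j))" by simp
    from polynomial_approximation_in_mean [OF holf bound this]
    obtain p where p: "p holomorphic_on UNIV"
      "\<And>\<rho>. 0 < \<rho> \<Longrightarrow> \<rho> < 1 \<Longrightarrow>
        integral {-pi..3*pi} (\<lambda>t. (norm (f (of_real \<rho> * cis t) - p (of_real \<rho> * cis t)))\<^sup>2) \<le> e / (5 * real (Suc j))"
      by blast
    let ?g = "\<lambda>z. (f z - p z)\<^sup>2"
    have holg: "?g holomorphic_on ball 0 1"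
      by (intro holomorphic_intros holf holomorphic_on_subset [OF p(1)]) auto
    have pos: "0 < 1 / real (Suc j)" by simp
    have mean: "integral {-pi..3*pi} (\<lambda>t. norm (?g (of_real \<rho> * cis t))) \<le> e / (5 * real (Suc j))"
      if "0 < \<rho>" "\<rho> < 1" for \<rho>
      using p(2) [OF that] by (simp only: norm_power)
    from radial_weak_type [OF holg pos mean]
    obtain U where U: "{\<theta>\<in>{0..2*pi}. \<exists>r. 0 \<le> r \<and> r < 1 \<and> 1 / real (Suc j) < norm (?g (of_real r * cis \<theta>))} \<subseteq> U"
      "U \<in> lmeasurable" "measure lebesgue U \<le> 5 / (1 / real (Suc j)) * (e / (5 * real (Suc j)))"
      by blast
    moreover have "5 / (1 / real (Suc j)) * (e / (5 * real (Suc j))) = e" by simp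
    moreover have "bad j \<subseteq> U"
      using U(1) p(1) unfolding bad_def by blast
    ultimately show "\<exists>T. bad j \<subseteq> T \<and> T \<in> lmeasurable \<and> measure lebesgue T \<le> e" by metis
  qed
  then have "negligible (\<Union>j. bad j)"
    by (rule negligible_Union_nat)
  moreover have "{\<theta>\<in>{0..2*pi}. \<not> (\<exists>L. ((\<lambda>r. f (of_real r * cis \<theta>)) \<longlongrightarrow> L) (at_left 1))} \<subseteq> (\<Union>j. bad j)"
  proof
    fix \<theta> assume "\<theta> \<in> {\<theta>\<in>{0..2*pi}. \<not> (\<exists>L. ((\<lambda>r. f (of_real r * cis \<theta>)) \<longlongrightarrow> L) (at_left 1))}"
    then have \<theta>: "\<theta> \<in> {0..2*pi}" and no: "\<not> (\<exists>L. ((\<lambda>r. f (of_real r * cis \<theta>)) \<longlongrightarrow> L) (at_left 1))"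
      by auto
    show "\<theta> \<in> (\<Union>j. bad j)"
    proof (rule ccontr)
      assume "\<theta> \<notin> (\<Union>j. bad j)"
      then have good: "\<exists>p. p holomorphic_on UNIV \<and> (\<forall>r. 0 \<le> r \<and> r < 1 \<longrightarrow>
          norm ((f (of_real r * cis \<theta>) - p (of_real r * cis \<theta>))\<^sup>2) \<le> 1 / real (Suc j))" for j
        using \<theta> unfolding bad_def by (force simp: not_less)
      have "uniformly_continuous_on {0..<1} (\<lambda>r. f (of_real r * cis \<theta>))"
        unfolding uniformly_continuous_on_def
      proof (intro allI impI)
        fix e :: real assume e: "0 < e"
        have "0 < e / 3" using e by simp
        then have "0 < (e / 3)\<^sup>2" by (rule zero_less_power)
        then obtain j where j: "1 / real (Suc j) < (e / 3)\<^sup>2"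
          by (rule nat_approx_posE)
        obtain p where p: "p holomorphic_on UNIV" "\<And>r. 0 \<le> r \<Longrightarrow> r < 1 \<Longrightarrow>
            norm ((f (of_real r * cis \<theta>) - p (of_real r * cis \<theta>))\<^sup>2) \<le> 1 / real (Suc j)"
          using good [of j] by blast
        have close: "dist (f (of_real r * cis \<theta>)) (p (of_real r * cis \<theta>)) < e / 3" if "0 \<le> r" "r < 1" for r
        proof -
          have "(dist (f (of_real r * cis \<theta>)) (p (of_real r * cis \<theta>)))\<^sup>2 < (e / 3)\<^sup>2"
            using p(2) [OF that] unfolding dist_norm norm_power by (rule order.strict_trans1 [OF _ j])
          then show ?thesis
            by (rule power2_less_imp_less) (use e in simp)
        qed
        have "continuous_on {0..1} (\<lambda>r::real. p (of_real r * cis \<theta>))"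
          by (intro continuous_on_compose2 [OF holomorphic_on_imp_continuous_on [OF p(1)]] continuous_intros) auto
        then have "uniformly_continuous_on {0..1} (\<lambda>r::real. p (of_real r * cis \<theta>))"
          by (rule compact_uniformly_continuous) simp
        then obtain d where d: "0 < d" "\<And>r s::real. r \<in> {0..1} \<Longrightarrow> s \<in> {0..1} \<Longrightarrow> dist s r < d \<Longrightarrow>
            dist (p (of_real s * cis \<theta>)) (p (of_real r * cis \<theta>)) < e / 3"
          using \<open>0 < e / 3\<close> unfolding uniformly_continuous_on_def by blast
        show "\<exists>d>0. \<forall>r\<in>{0..<1}. \<forall>s\<in>{0..<1}. dist s r < d \<longrightarrow> dist (f (of_real s * cis \<theta>)) (f (of_real r * cis \<theta>)) < e"
        proof (intro exI [of _ d] conjI d ballI impI)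
          fix r s :: real assume *: "r \<in> {0..<1}" "s \<in> {0..<1}" "dist s r < d"
          have "dist (p (of_real s * cis \<theta>)) (p (of_real r * cis \<theta>)) < e / 3"
            using * by (intro d) auto
          moreover have "dist (f (of_real s * cis \<theta>)) (p (of_real s * cis \<theta>)) < e / 3"
            using * by (intro close) auto
          moreover have "dist (p (of_real r * cis \<theta>)) (f (of_real r * cis \<theta>)) < e / 3"
            using * by (subst dist_commute, intro close) auto
          ultimately show "dist (f (of_real s * cis \<theta>)) (f (of_real r * cis \<theta>)) < e"
            by (blast intro: dist_triangle_third)
        qed
      qed
      moreover have "(1::real) \<in> closure {0..<1}" by simp
      ultimately obtain L where L: "((\<lambda>r. f (of_real r * cis \<theta>)) \<longlongrightarrow> L) (at 1 within {0..<1})"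
        using uniformly_continuous_on_extension_at_closure by blast
      have "at 1 within {0..<1} = at_left (1::real)"
        by (rule at_within_nhd [of _ "{0<..}"]) auto
      then show False using L no by auto
    qed
  qed
  ultimately show ?thesis by (rule negligible_subset)
qed

section \<open>Weak-star convergence to the constant 1\<close>

abbreviation circle_measure :: "real measure" where
  "circle_measure \<equiv> lebesgue_on {0..2*pi}"

lemma circle_measure_finite: "finite_measure circle_measure"
  by (rule finite_measure_lebesgue_on) simp

lemma schur_radial_continuous:
  assumes "u \<in> schur_class" "0 \<le> r" "r < 1"
  shows "continuous_on S (\<lambda>t. u (of_real r * cis t))"
  by (intro continuous_on_compose2 [OF holomorphic_on_imp_continuous_on [OF schur_class_holomorphic [OF assms(1)]]] continuous_intros)
    (use assms in \<open>auto simp: norm_mult\<close>)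

lemma boundary_fun_limit:
  assumes u: "u \<in> schur_class"
  shows "AE t in circle_measure. ((\<lambda>r. u (of_real r * cis t)) \<longlongrightarrow> boundary_fun u t) (at_left 1)"
proof -
  let ?N = "{\<theta>\<in>{0..2*pi}. \<not> (\<exists>L. ((\<lambda>r. u (of_real r * cis \<theta>)) \<longlongrightarrow> L) (at_left 1))}"
  have "negligible ?N"
    by (rule fatou_radial_limits [OF schur_class_holomorphic [OF u], of 1]) (rule schur_class_norm [OF u])
  then have "?N \<in> null_sets lebesgue"
    by (simp add: negligible_iff_null_sets)
  then have "AE t in lebesgue. t \<notin> ?N"
    by (rule AE_not_in)
  then have "AE t in lebesgue. t \<in> {0..2*pi} \<longrightarrow> ((\<lambda>r. u (of_real r * cis t)) \<longlongrightarrow> boundary_fun u t) (at_left 1)"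
  proof eventually_elim
    case (elim t)
    show ?case
    proof
      assume "t \<in> {0..2*pi}"
      with elim obtain L where L: "((\<lambda>r. u (of_real r * cis t)) \<longlongrightarrow> L) (at_left 1)" by blast
      then have "boundary_fun u t = L"
        unfolding boundary_fun_def by (intro tendsto_Lim) auto
      then show "((\<lambda>r. u (of_real r * cis t)) \<longlongrightarrow> boundary_fun u t) (at_left 1)" using L by simp
    qed
  qed
  then show ?thesis
    by (subst AE_restrict_space_iff) auto
qed

text \<open>A sequence tending to 1 from below, through which measurability and dominated convergence
  become accessible.\<close>

definition radii :: "nat \<Rightarrow> real" where
  "radii n = 1 - 1 / real (Suc n)"

lemma radii: "0 \<le> radii n" "radii n < 1"
  by (auto simp: radii_def)

lemma radii_tendsto: "filterlim radii (at_left 1) sequentially"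
proof (rule filterlim_at_withinI)
  have "(\<lambda>n. 1 - 1 / real (Suc n)) \<longlonglongrightarrow> 1 - 0"
    using LIMSEQ_inverse_real_of_nat by (intro tendsto_diff tendsto_const) (simp add: inverse_eq_divide)
  then show "radii \<longlonglongrightarrow> 1" by (simp add: radii_def [abs_def])
  show "\<forall>\<^sub>F n in sequentially. radii n \<in> {..<1} - {1}"
    using radii(2) by (simp add: less_imp_neq)
qed

lemma boundary_fun_limit_radii:
  assumes u: "u \<in> schur_class"
  shows "AE t in circle_measure. (\<lambda>n. u (of_real (radii n) * cis t)) \<longlonglongrightarrow> boundary_fun u t"
  using boundary_fun_limit [OF u] by eventually_elim (rule filterlim_compose [OF _ radii_tendsto])

lemma radial_measurable:
  assumes u: "u \<in> schur_class" "0 \<le> r" "r < 1"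
  shows "(\<lambda>t. u (of_real r * cis t)) \<in> borel_measurable circle_measure"
  by (rule continuous_imp_measurable_on_sets_lebesgue) (use schur_radial_continuous [OF u] in auto)

lemma boundary_fun_measurable:
  assumes u: "u \<in> schur_class"
  shows "boundary_fun u \<in> borel_measurable circle_measure"
proof -
  let ?S = "{0..2*pi}"
  let ?h = "\<lambda>t. lim (\<lambda>n. u (of_real (radii n) * cis t))"
  have "?h \<in> borel_measurable circle_measure"
    using radial_measurable [OF u radii] by (rule borel_measurable_lim_metric)
  then have h: "(\<lambda>t. if t \<in> ?S then ?h t else 0) \<in> borel_measurable lebesgue"
    by (subst borel_measurable_if) auto
  have "AE t in lebesgue. t \<in> ?S \<longrightarrow> (\<lambda>n. u (of_real (radii n) * cis t)) \<longlonglongrightarrow> boundary_fun u t"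
    using boundary_fun_limit_radii [OF u] by (subst (asm) AE_restrict_space_iff) auto
  then have "AE t in lebesgue. (if t \<in> ?S then ?h t else 0) = (if t \<in> ?S then boundary_fun u t else 0)"
    by eventually_elim (auto simp: limI)
  from borel_measurable_AE [OF h this] show ?thesis
    by (subst (asm) borel_measurable_if) auto
qed

lemma boundary_fun_norm:
  assumes u: "u \<in> schur_class"
  shows "AE t in circle_measure. norm (boundary_fun u t) \<le> 1"
  using boundary_fun_limit_radii [OF u]
proof eventually_elim
  case (elim t)
  show ?case
  proof (rule tendsto_upperbound [OF tendsto_norm [OF elim]])
    show "\<forall>\<^sub>F n in sequentially. norm (u (of_real (radii n) * cis t)) \<le> 1"
      using radii by (intro always_eventually allI schur_class_norm [OF u]) (simp add: norm_mult)
  qed simp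
qed

lemma norm_one_minus_square_le:
  assumes "norm (z::complex) \<le> 1"
  shows "(norm (1 - z))\<^sup>2 \<le> 2 - 2 * Re z"
proof -
  have "(Re z)\<^sup>2 + (Im z)\<^sup>2 \<le> 1"
    using power_mono [OF assms norm_ge_zero, of 2] by (simp add: cmod_power2)
  then show ?thesis
    unfolding cmod_power2 by (simp add: power2_eq_square algebra_simps)
qed

text \<open>On a circle inside the disk, \<open>|1 - u|\<^sup>2 \<le> 2 - 2 Re u\<close> and the mean of \<open>u\<close> is \<open>u 0\<close>. Dominated
  convergence carries the estimate over to the boundary.\<close>

lemma boundary_distance_from_one:
  assumes u: "u \<in> schur_class"
  shows "integrable circle_measure (\<lambda>t. (norm (1 - boundary_fun u t))\<^sup>2)"
    and "(\<integral>t. (norm (1 - boundary_fun u t))\<^sup>2 \<partial>circle_measure) \<le> 4 * pi * (1 - Re (u 0))"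
proof -
  interpret finite_measure circle_measure by (rule circle_measure_finite)
  let ?s = "\<lambda>n t. (norm (1 - u (of_real (radii n) * cis t)))\<^sup>2"
  have lim: "AE t in circle_measure. (\<lambda>n. ?s n t) \<longlonglongrightarrow> (norm (1 - boundary_fun u t))\<^sup>2"
    using boundary_fun_limit_radii [OF u] by eventually_elim (intro tendsto_intros)
  have meas: "(\<lambda>t. (norm (1 - boundary_fun u t))\<^sup>2) \<in> borel_measurable circle_measure"
    using boundary_fun_measurable [OF u] by simp
  have meas': "?s n \<in> borel_measurable circle_measure" for n
    using radial_measurable [OF u radii, of n] by simp
  have in_disk: "norm (u (of_real (radii n) * cis t)) \<le> 1" for n t
    using radii by (intro schur_class_norm [OF u]) (simp add: norm_mult)
  have bound: "AE t in circle_measure. norm (?s n t) \<le> 4" for n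
  proof (intro AE_I2)
    fix t
    have "norm (1 - u (of_real (radii n) * cis t)) \<le> 2"
      using norm_triangle_ineq4 [of 1 "u (of_real (radii n) * cis t)"] in_disk [of n t] by simp
    from power_mono [OF this norm_ge_zero, of 2] show "norm (?s n t) \<le> 4" by simp
  qed
  show "integrable circle_measure (\<lambda>t. (norm (1 - boundary_fun u t))\<^sup>2)"
    by (rule integrable_dominated_convergence [OF meas meas' _ lim bound]) simp
  have "(\<lambda>n. \<integral>t. ?s n t \<partial>circle_measure) \<longlonglongrightarrow> (\<integral>t. (norm (1 - boundary_fun u t))\<^sup>2 \<partial>circle_measure)"
    by (rule integral_dominated_convergence [OF meas meas' _ lim bound]) simp
  then show "(\<integral>t. (norm (1 - boundary_fun u t))\<^sup>2 \<partial>circle_measure) \<le> 4 * pi * (1 - Re (u 0))"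
  proof (rule LIMSEQ_le_const2, intro exI allI impI)
    fix n
    have cont: "continuous_on S (\<lambda>t. u (of_real (radii n) * cis t))" for S
      by (rule schur_radial_continuous [OF u radii])
    have disk: "of_real (radii n) * w \<in> ball 0 1" if "norm w \<le> 1" for w :: complex
    proof -
      have "radii n * norm w \<le> radii n * 1" using that radii by (intro mult_left_mono) auto
      then have "radii n * norm w < 1" using radii(2) [of n] by linarith
      then show ?thesis using radii [of n] by (simp add: norm_mult)
    qed
    \<comment> \<open>The Poisson formula at the centre is the mean value property.\<close>
    have "((\<lambda>t. u (of_real (radii n) * cis t) * of_real (poisson_kernel 0 t)) has_integral
        2 * of_real pi * u (of_real (radii n) * of_real 0)) {0..2*pi}"
    proof (rule poisson_formula)
      show "continuous_on (cball 0 1) (\<lambda>w. u (of_real (radii n) * w))"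
        by (intro continuous_on_compose2 [OF holomorphic_on_imp_continuous_on [OF schur_class_holomorphic [OF u]]] continuous_intros)
          (use disk in auto)
      show "(\<lambda>w. u (of_real (radii n) * w)) holomorphic_on ball 0 1"
        by (rule holomorphic_on_compose_gen [OF _ schur_class_holomorphic [OF u], unfolded o_def])
          (use disk in \<open>auto intro!: holomorphic_intros\<close>)
    qed auto
    then have "((\<lambda>t. u (of_real (radii n) * cis t)) has_integral 2 * of_real pi * u 0) {0..2*pi}"
      by (simp add: poisson_kernel_def)
    from has_integral_Re [OF this]
    have "((\<lambda>t. Re (u (of_real (radii n) * cis t))) has_integral 2 * pi * Re (u 0)) {0..2*pi}"
      by simp
    then have mean: "((\<lambda>t. 2 - 2 * Re (u (of_real (radii n) * cis t))) has_integral 2 * (2 * pi) - 2 * (2 * pi * Re (u 0))) {0..2*pi}"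
      using has_integral_const_real [of "2::real" 0 "2*pi"] by (intro has_integral_diff has_integral_mult_right) (auto simp: mult.commute)
    have "(?s n has_integral integral {0..2*pi} (?s n)) {0..2*pi}"
      by (intro integrable_integral integrable_continuous_interval continuous_intros cont)
    then have "integral {0..2*pi} (?s n) \<le> 2 * (2 * pi) - 2 * (2 * pi * Re (u 0))"
      using mean by (rule has_integral_le) (intro norm_one_minus_square_le in_disk)
    moreover have "(\<integral>t. ?s n t \<partial>circle_measure) = integral {0..2*pi} (?s n)"
      by (rule lebesgue_integral_eq_integral, rule integrable_const_bound [OF bound meas']) simp
    ultimately show "(\<integral>t. ?s n t \<partial>circle_measure) \<le> 4 * pi * (1 - Re (u 0))"
      by (simp add: algebra_simps)
  qed
qed

lemma boundary_fun_one: "boundary_fun (on_disk (\<lambda>z. 1)) t = 1"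
  unfolding boundary_fun_def
proof (rule tendsto_Lim)
  have "\<forall>\<^sub>F r in at_left (1::real). 1 = on_disk (\<lambda>z. 1) (of_real r * cis t)"
    using eventually_at_left_real [of 0 1] by (auto elim!: eventually_mono simp: norm_mult)
  then show "((\<lambda>r. on_disk (\<lambda>z. 1) (of_real r * cis t)) \<longlongrightarrow> 1) (at_left 1)"
    by (rule tendsto_eventually [OF eventually_mono]) simp
qed simp

lemma subsequence_boundary_tendsto_one:
  assumes w: "\<And>n. w n \<in> schur_class" and lim: "(\<lambda>n. w n 0) \<longlonglongrightarrow> 1"
  obtains r where "strict_mono r" "AE t in circle_measure. (\<lambda>n. boundary_fun (w (r n)) t) \<longlonglongrightarrow> 1"
proof -
  let ?d = "\<lambda>n t. (norm (1 - boundary_fun (w n) t))\<^sup>2"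
  have "(\<lambda>n. 4 * pi * (1 - Re (w n 0))) \<longlonglongrightarrow> 4 * pi * (1 - Re 1)"
    by (intro tendsto_intros lim)
  then have "(\<lambda>n. 4 * pi * (1 - Re (w n 0))) \<longlonglongrightarrow> 0" by simp
  then have "(\<lambda>n. \<integral>t. norm (?d n t) \<partial>circle_measure) \<longlonglongrightarrow> 0"
    by (rule tendsto_sandwich [OF _ _ tendsto_const, rotated 2])
      (use boundary_distance_from_one(2) [OF w] in \<open>auto intro!: always_eventually\<close>)
  from tendsto_L1_AE_subseq [OF boundary_distance_from_one(1) [OF w] this]
  obtain r where r: "strict_mono r" "AE t in circle_measure. (\<lambda>n. ?d (r n) t) \<longlonglongrightarrow> 0"
    by blast
  from r(2) have "AE t in circle_measure. (\<lambda>n. boundary_fun (w (r n)) t) \<longlonglongrightarrow> 1"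
  proof eventually_elim
    case (elim t)
    from tendsto_real_sqrt [OF elim] have "(\<lambda>n. norm (boundary_fun (w (r n)) t - 1)) \<longlonglongrightarrow> 0"
      by (simp add: norm_minus_commute)
    then show ?case by (simp add: LIM_zero_cancel tendsto_norm_zero_iff)
  qed
  then show thesis using that r(1) by blast
qed

lemma eventually_in_weak_star_neighbourhood:
  assumes w: "\<And>n. w n \<in> schur_class"
    and lim: "AE t in circle_measure. (\<lambda>n. boundary_fun (w n) t) \<longlonglongrightarrow> 1"
    and W: "openin Hinf_weak_star W" "on_disk (\<lambda>z. 1) \<in> W"
  shows "\<forall>\<^sub>F n in sequentially. w n \<in> W"
proof -
  have sub: "\<forall>\<^sub>F n in sequentially. w n \<in> {u \<in> Hinf. (\<integral>t. boundary_fun u t * g t \<partial>circle_measure) \<in> U}"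
    if g: "integrable circle_measure g" and U: "open U" "(\<integral>t. boundary_fun (on_disk (\<lambda>z. 1)) t * g t \<partial>circle_measure) \<in> U" for g U
  proof -
    have tendsto: "(\<lambda>n. \<integral>t. boundary_fun (w n) t * g t \<partial>circle_measure) \<longlonglongrightarrow> (\<integral>t. g t \<partial>circle_measure)"
    proof (rule integral_dominated_convergence)
      show "g \<in> borel_measurable circle_measure" "integrable circle_measure (\<lambda>t. norm (g t))"
        using g by auto
      show "(\<lambda>t. boundary_fun (w n) t * g t) \<in> borel_measurable circle_measure" for n
        using g boundary_fun_measurable [OF w] by (intro borel_measurable_times) auto
      show "AE t in circle_measure. (\<lambda>n. boundary_fun (w n) t * g t) \<longlonglongrightarrow> g t"
        using lim
      proof eventually_elim
        case (elim t)
        from tendsto_mult [OF elim tendsto_const [of "g t"]] show ?case by simp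
      qed
      show "AE t in circle_measure. norm (boundary_fun (w n) t * g t) \<le> norm (g t)" for n
        using boundary_fun_norm [OF w [of n]]
        by eventually_elim (simp add: norm_mult mult_left_le_one_le)
    qed
    have "(\<integral>t. g t \<partial>circle_measure) \<in> U"
      using U(2) by (simp add: boundary_fun_one)
    then have "\<forall>\<^sub>F n in sequentially. (\<integral>t. boundary_fun (w n) t * g t \<partial>circle_measure) \<in> U"
      by (rule topological_tendstoD [OF tendsto U(1)])
    then show ?thesis
      using schur_class_Hinf [OF w] by (auto elim!: eventually_mono)
  qed
  have "generate_topology_on {{u \<in> Hinf. f u \<in> U} |f U. f \<in> {\<lambda>u. integral\<^sup>L circle_measure (\<lambda>t. boundary_fun u t * g t) |g.
        integrable circle_measure g} \<and> open U} W"
    using W(1) by (simp only: Hinf_weak_star_def weak_topology_def openin_topology_generated_by_iff)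
  then show ?thesis
    using W(2)
  proof induction
    case (Int a b)
    then show ?case by (simp add: eventually_conj_iff)
  next
    case (UN K)
    then obtain k where k: "k \<in> K" "on_disk (\<lambda>z. 1) \<in> k" by blast
    then have "\<forall>\<^sub>F n in sequentially. w n \<in> k" by (rule UN.IH)
    then show ?case using k by (auto elim!: eventually_mono)
  next
    case (Basis s)
    then obtain g U where s: "s = {u \<in> Hinf. (\<integral>t. boundary_fun u t * g t \<partial>circle_measure) \<in> U}"
      and g: "integrable circle_measure g" and U: "open U" by blast
    then show ?case using sub [OF g U] Basis.prems by simp
  qed simp
qed

section \<open>Invariant subspaces\<close>

lemma cinner_zero_left [simp]: "cinner 0 y = 0"
  using cinner_scaleC_left [of 0 0 y] by simp

lemma cinner_diff_left: "cinner (x - y) z = cinner x z - cinner y z"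
  using cinner_add_left [of "x - y" y z] by simp

lemma Re_cinner_polarization: "4 * Re (cinner x y) = (norm (x + y))\<^sup>2 - (norm (x - y))\<^sup>2"
proof -
  have exp: "complex_of_real ((norm (x + a *\<^sub>C y))\<^sup>2) =
      cinner x x + cnj a * cinner x y + a * cnj (cinner x y) + a * cnj a * cinner y y" for a
  proof -
    have right: "cinner z (x + a *\<^sub>C y) = cinner z x + cnj a * cinner z y" for z
      by (subst (1 2 3) cinner_commute) (simp add: cinner_add_left cinner_scaleC_left)
    show ?thesis
      unfolding cinner_self [symmetric] right
      by (simp add: cinner_add_left cinner_scaleC_left cinner_commute [of y x] algebra_simps)
  qed
  have "complex_of_real ((norm (x + y))\<^sup>2) - complex_of_real ((norm (x - y))\<^sup>2) = 2 * (cinner x y + cnj (cinner x y))"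
    using exp [of 1] exp [of "-1"] by simp
  from arg_cong [OF this, of Re] show ?thesis by simp
qed

text \<open>By polarisation the real and imaginary part of the inner product are continuous, since they are
  expressed by norms.\<close>

lemma closed_orthogonal: "closed {x. cinner x y = 0}"
proof -
  have re: "continuous_on UNIV (\<lambda>x. Re (cinner x y))" for y :: 'a
  proof -
    have "(\<lambda>x. Re (cinner x y)) = (\<lambda>x. ((norm (x + y))\<^sup>2 - (norm (x - y))\<^sup>2) / 4)"
      by (simp flip: Re_cinner_polarization)
    then show ?thesis by (simp only:) (intro continuous_intros, simp)
  qed
  have "Im (cinner x y) = Re (cinner x (\<i> *\<^sub>C y))" for x
    by (subst (2) cinner_commute) (simp add: cinner_scaleC_left cinner_commute [of x y])
  then have "{x. cinner x y = 0} = {x. Re (cinner x y) = 0} \<inter> {x. Re (cinner x (\<i> *\<^sub>C y)) = 0}"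
    by (auto simp: complex_eq_iff)
  also have "closed \<dots>"
    by (intro closed_Int closed_Collect_eq re continuous_on_const)
  finally show ?thesis .
qed

lemma infinite_dimensional_nonzero:
  assumes "infinite_dimensional TYPE('h)"
  obtains e :: "'h::complex_hilbert" where "e \<noteq> 0"
proof (rule ccontr)
  assume "\<not> thesis"
  then have "cspan {} = (UNIV :: 'h set)" using that by auto
  then show False using assms unfolding infinite_dimensional_def by blast
qed

text \<open>Every subspace is invariant under a scalar operator; the orthogonal complement of a vector
  \<open>e \<noteq> 0\<close> is closed, and it is not \<open>{0}\<close> because \<open>e\<close> does not span the space.\<close>

lemma scalar_operator_invariant_subspace:
  fixes T :: "'h::complex_hilbert \<Rightarrow>\<^sub>L 'h"
  assumes inf: "infinite_dimensional TYPE('h)" and T: "\<And>x. T x = a *\<^sub>C x"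
  shows "\<exists>M. nontrivial_invariant_subspace T M"
proof -
  obtain e :: 'h where e: "e \<noteq> 0"
    using infinite_dimensional_nonzero [OF inf] .
  then have ee: "cinner e e \<noteq> 0" by (simp add: cinner_self)
  let ?M = "{x. cinner x e = 0}"
  have "csubspace ?M"
    by (intro complex_vector.subspaceI) (auto simp: cinner_add_left cinner_scaleC_left)
  then have "invariant_subspace T ?M"
    using closed_orthogonal [of e] by (auto simp: invariant_subspace_def T cinner_scaleC_left)
  moreover have "?M \<noteq> UNIV" using ee by auto
  moreover have "?M \<noteq> {0}"
  proof
    assume M: "?M = {0}"
    have "x \<in> cspan {e}" for x
    proof -
      let ?c = "cinner x e / cinner e e"
      have "x - ?c *\<^sub>C e \<in> ?M" using ee by (simp add: cinner_diff_left cinner_scaleC_left)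
      then have "x = ?c *\<^sub>C e" unfolding M by simp
      moreover have "?c *\<^sub>C e \<in> cspan {e}"
        by (intro complex_vector.span_scale complex_vector.span_base) simp
      ultimately show ?thesis by (simp only:)
    qed
    then have "cspan {e} = UNIV" by blast
    then show False using inf unfolding infinite_dimensional_def by blast
  qed
  ultimately show ?thesis unfolding nontrivial_invariant_subspace_def by blast
qed

text \<open>If \<open>\<Phi> u\<close> is injective and \<open>\<Phi> u \<circ> \<Phi> v = 0\<close>, then \<open>\<Phi> v = 0\<close>. The Moebius function with zero
  \<open>a\<close> is a divisor of \<open>z - a\<close>, so if \<open>\<Phi>\<close> annihilates it, then \<open>T = a\<close>.\<close>

lemma calculus_kernel_prime:
  fixes T :: "'h::complex_hilbert \<Rightarrow>\<^sub>L 'h"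
  assumes inf: "infinite_dimensional TYPE('h)" and calc: "sz_nagy_foias_calculus T \<Phi>"
    and no: "\<nexists>M. nontrivial_invariant_subspace T M"
  shows "prime_without_moebius {u \<in> Hinf. \<Phi> u = 0}"
proof -
  let ?z = "on_disk (\<lambda>z. z)"
  have bdd: "\<And>u c x. u \<in> Hinf \<Longrightarrow> \<Phi> u (c *\<^sub>C x) = c *\<^sub>C \<Phi> u x"
    and add: "\<And>u v. u \<in> Hinf \<Longrightarrow> v \<in> Hinf \<Longrightarrow> \<Phi> (\<lambda>z. u z + v z) = \<Phi> u + \<Phi> v"
    and scale: "\<And>c u x. u \<in> Hinf \<Longrightarrow> \<Phi> (\<lambda>z. c * u z) x = c *\<^sub>C \<Phi> u x"
    and mult: "\<And>u v. u \<in> Hinf \<Longrightarrow> v \<in> Hinf \<Longrightarrow> \<Phi> (\<lambda>z. u z * v z) = \<Phi> u o\<^sub>L \<Phi> v"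
    and one: "\<Phi> (on_disk (\<lambda>z. 1)) = id_blinfun" and z: "\<Phi> ?z = T"
    using calc by (auto simp: sz_nagy_foias_calculus_def algebra_representation_def bounded_operators_def)
  have zH: "?z \<in> Hinf" and oneH: "on_disk (\<lambda>z. 1) \<in> Hinf"
    by (auto intro!: on_disk_in_Hinf [of _ 1])
  have kernel: "{x. \<Phi> u x = 0} = {0} \<or> \<Phi> u = 0" if u: "u \<in> Hinf" for u
  proof -
    let ?M = "{x. \<Phi> u x = 0}"
    have "csubspace ?M"
      by (intro complex_vector.subspaceI) (auto simp: blinfun.add_right blinfun.zero_right bdd [OF u])
    moreover have "closed ?M"
      by (intro closed_Collect_eq continuous_intros)
    moreover have "\<Phi> u o\<^sub>L T = T o\<^sub>L \<Phi> u"
      using mult [OF u zH] mult [OF zH u] by (simp add: z mult.commute)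
    then have "\<Phi> u (T x) = T (\<Phi> u x)" for x
      by (metis blinfun_apply_blinfun_compose)
    then have "T ` ?M \<subseteq> ?M"
      by (auto simp: blinfun.zero_right)
    ultimately have "invariant_subspace T ?M"
      by (simp add: invariant_subspace_def)
    then have "?M = {0} \<or> ?M = UNIV"
      using no by (auto simp: nontrivial_invariant_subspace_def)
    moreover have "\<Phi> u = 0" if "?M = UNIV"
      using that by (intro blinfun_eqI) auto
    ultimately show ?thesis by blast
  qed
  show ?thesis
  proof
    fix u v assume "u \<in> {u \<in> Hinf. \<Phi> u = 0}" "v \<in> Hinf"
    then show "(\<lambda>z. v z * u z) \<in> {u \<in> Hinf. \<Phi> u = 0}"
      by (auto simp: mult Hinf_mult intro!: blinfun_eqI)
  next
    fix u v assume uv: "u \<in> Hinf" "v \<in> Hinf" "(\<lambda>z. u z * v z) \<in> {u \<in> Hinf. \<Phi> u = 0}"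
    then have zero: "\<Phi> v x \<in> {x. \<Phi> u x = 0}" for x
      by (metis (mono_tags, lifting) blinfun.zero_left blinfun_apply_blinfun_compose mem_Collect_eq mult)
    have "\<Phi> v = 0" if "{x. \<Phi> u x = 0} = {0}"
      using zero unfolding that by (intro blinfun_eqI) simp
    then have "\<Phi> u = 0 \<or> \<Phi> v = 0"
      using kernel [OF uv(1)] by blast
    then show "u \<in> {u \<in> Hinf. \<Phi> u = 0} \<or> v \<in> {u \<in> Hinf. \<Phi> u = 0}"
      using uv by blast
  next
    fix a :: complex assume a: "norm a < 1"
    let ?m = "on_disk (Moebius_function 0 a)" and ?d = "on_disk (\<lambda>z. 1 - cnj a * z)"
    show "?m \<notin> {u \<in> Hinf. \<Phi> u = 0}"
    proof
      assume m: "?m \<in> {u \<in> Hinf. \<Phi> u = 0}"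
      have dH: "?d \<in> Hinf"
      proof (rule on_disk_in_Hinf)
        fix z :: complex assume z: "norm z < 1"
        have "norm (1 - cnj a * z) \<le> 1 + norm a * norm z"
          by (metis complex_mod_cnj norm_mult norm_one norm_triangle_ineq4)
        also have "\<dots> \<le> 1 + 1 * 1"
          using a z by (intro add_mono mult_mono) auto
        finally show "norm (1 - cnj a * z) \<le> 2" by simp
      qed (intro holomorphic_intros)
      have aH: "(\<lambda>z. - a * on_disk (\<lambda>z. 1) z) \<in> Hinf"
      proof -
        have "on_disk (\<lambda>z. - a) \<in> Hinf" by (rule on_disk_in_Hinf [of _ "norm a"]) auto
        moreover have "on_disk (\<lambda>z. - a) = (\<lambda>z. - a * on_disk (\<lambda>z. 1) z)" by (auto simp: on_disk_def)
        ultimately show ?thesis by simp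
      qed
      have "(\<lambda>z. ?m z * ?d z) = (\<lambda>z. ?z z + - a * on_disk (\<lambda>z. 1) z)"
      proof
        fix z
        have "1 - cnj a * z \<noteq> 0" if "norm z < 1"
          using moebius_denominator_nonzero [OF a that] .
        then show "?m z * ?d z = ?z z + - a * on_disk (\<lambda>z. 1) z"
          by (simp add: on_disk_def Moebius_function_simple)
      qed
      moreover have "\<Phi> (\<lambda>z. ?m z * ?d z) = 0"
        using m dH by (auto simp: mult intro!: blinfun_eqI)
      ultimately have "\<Phi> (\<lambda>z. ?z z + - a * on_disk (\<lambda>z. 1) z) x = 0" for x
        by simp
      then have "T x + - a *\<^sub>C x = 0" for x
        by (simp only: add [OF zH aH] z blinfun.add_left scale [OF oneH] one id_blinfun.rep_eq id_apply)
      then have "T x = a *\<^sub>C x" for x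
        by (simp add: complex_vector.scale_minus_left)
      then show False using scalar_operator_invariant_subspace [OF inf] no by blast
    qed
  qed
qed

lemma openin_weak_topology:
  assumes "f \<in> F" "open U"
  shows "openin (weak_topology S F) {x \<in> S. f x \<in> U}"
  unfolding weak_topology_def by (rule topology_generated_by_Basis) (use assms in blast)

theorem corollary2p4:
  fixes T :: "'h::complex_hilbert \<Rightarrow>\<^sub>L 'h"
  assumes "separable_space (euclidean :: 'h topology)"
    and "infinite_dimensional TYPE('h)"
    and "class_C0 T"
  shows "\<exists>M. nontrivial_invariant_subspace T M"
proof (rule ccontr)
  assume no: "\<nexists>M. nontrivial_invariant_subspace T M"
  obtain \<Phi> where calc: "sz_nagy_foias_calculus T \<Phi>" and ker: "{u \<in> Hinf. \<Phi> u = 0} \<noteq> {\<lambda>z. 0}"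
    using assms(3) unfolding class_C0_def by blast
  let ?K = "{u \<in> Hinf. \<Phi> u = 0}"
  interpret prime_without_moebius ?K
    by (rule calculus_kernel_prime [OF assms(2) calc no])
  have zero: "(\<lambda>z. 0) \<in> Hinf"
    using on_disk_in_Hinf [of "\<lambda>z. 0" 0] by (simp add: on_disk_def)
  \<comment> \<open>The kernel contains 0, so being different from \<open>{0}\<close> it has a non-zero element.\<close>
  have "\<exists>u\<in>?K. u \<noteq> (\<lambda>z. 0)"
  proof (rule ccontr)
    assume *: "\<not> ?thesis"
    then have "?K \<subseteq> {\<lambda>z. 0}" by blast
    then have empty: "?K = {}" using ker by blast
    have "\<Phi> (\<lambda>z. u z + v z) = \<Phi> u + \<Phi> v" if "u \<in> Hinf" "v \<in> Hinf" for u v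
      using calc that by (simp add: sz_nagy_foias_calculus_def algebra_representation_def)
    from this [OF zero zero] have "\<Phi> (\<lambda>z. 0) = 0" by simp
    then show False using empty zero by blast
  qed
  then obtain u where u: "u \<in> ?K" "u \<in> Hinf" "u \<noteq> (\<lambda>z. 0)" by blast
  obtain w where w: "\<And>n. w n \<in> ?K" "\<And>n. w n \<in> schur_class" "(\<lambda>n. w n 0) \<longlonglongrightarrow> 1"
    using approximates_one [OF u] by blast
  obtain r where "AE t in circle_measure. (\<lambda>n. boundary_fun (w (r n)) t) \<longlonglongrightarrow> 1"
    using subsequence_boundary_tendsto_one [OF w(2,3)] by blast
  note near_one = eventually_in_weak_star_neighbourhood [OF w(2) this]
  obtain x :: 'h where x: "x \<noteq> 0"
    using infinite_dimensional_nonzero [OF assms(2)] .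
  \<comment> \<open>The trace class operator \<open>\<langle>\<cdot>, x\<rangle> x\<close>, as a series with a single non-zero term.\<close>
  define X where "X = (\<lambda>n::nat. if n = 0 then x else 0)"
  have pairing: "(\<Sum>n. cinner (blinfun_apply A (X n)) (X n)) = cinner (A x) x" for A :: "'h \<Rightarrow>\<^sub>L 'h"
    by (subst suminf_finite [of "{0}"]) (auto simp: X_def blinfun.zero_right)
  have X_summable: "summable (\<lambda>n. (norm (X n))\<^sup>2)"
    by (rule summable_finite [of "{0}"]) (auto simp: X_def)
  \<comment> \<open>A weak-star open set of operators that contains the identity, but not 0.\<close>
  let ?V = "{A \<in> bounded_operators. (\<Sum>n. cinner (blinfun_apply A (X n)) (X n)) \<in> - {0}}"
  have "openin operator_weak_star ?V"
    unfolding operator_weak_star_def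
    using X_summable by - (rule openin_weak_topology, intro CollectI exI conjI refl, simp_all add: open_Compl)
  moreover have "continuous_map Hinf_weak_star operator_weak_star \<Phi>"
    using calc by (simp add: sz_nagy_foias_calculus_def)
  ultimately have W: "openin Hinf_weak_star {u \<in> topspace Hinf_weak_star. \<Phi> u \<in> ?V}"
    by (intro openin_continuous_map_preimage)
  have oneH: "on_disk (\<lambda>z. 1) \<in> Hinf"
    by (rule on_disk_in_Hinf [of _ 1]) auto
  have "on_disk (\<lambda>z. 1) \<in> {u \<in> topspace Hinf_weak_star. \<Phi> u \<in> ?V}"
  proof -
    have "openin Hinf_weak_star {u \<in> Hinf. (\<integral>t. boundary_fun u t * g t \<partial>circle_measure) \<in> UNIV}"
      if "integrable circle_measure g" for g
      unfolding Hinf_weak_star_def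
      using that by - (rule openin_weak_topology, intro CollectI exI conjI refl, simp_all)
    from this [OF integrable_zero]
    have "Hinf \<subseteq> topspace Hinf_weak_star"
      using openin_subset by force
    moreover have "\<Phi> (on_disk (\<lambda>z. 1)) = id_blinfun" "\<Phi> ` Hinf \<subseteq> bounded_operators"
      using calc by (auto simp: sz_nagy_foias_calculus_def algebra_representation_def)
    ultimately show ?thesis
      using oneH x by (auto simp: pairing cinner_self)
  qed
  from near_one [OF W this] have "\<forall>\<^sub>F n in sequentially. \<Phi> (w (r n)) \<in> ?V"
    by (auto elim!: eventually_mono)
  from eventually_happens' [OF sequentially_bot this] have "\<exists>n. \<Phi> (w (r n)) \<in> ?V" .
  moreover have "\<Phi> (w (r n)) \<notin> ?V" for n
    using w(1) by (simp add: pairing)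
  ultimately show False by blast
qed


end
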